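(* Let $c>1$ be a constant, let $s=s(n)\ge1$ be an integer, and let $G$ be a random graph from $G(n,p)$ with $p=\frac{c\log n}{n}$. Give each edge of $G$ a color from $[s]$ independently and uniformly at random. If $$s\ge \frac{\log n}{\log c-1+\log\log n}+\frac32+\frac{2\sqrt{\log\log\log n}}{\log\log n},$$ then asymptotically almost surely $G$ is rainbow connected.
   Context: $\log$ is the natural logarithm. A path in the edge-colored graph $G$ is rainbow if its edges have pairwise distinct colors; $G$ is rainbow connected if every pair of distinct vertices is joined by a rainbow path. "Asymptotically almost surely" means with probability tending to $1$ as $n\to\infty$. *)

theory Defs
  imports "HOL-Probability.Probability"
begin

text \<open>Undirected simple graphs: an edge is a two-element set of vertices, and an edge
  colouring is a function on such sets.\<close>

definition complete_edges :: "nat \<Rightarrow> nat set set" where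
  "complete_edges n = {e. e \<subseteq> {1..n} \<and> card e = 2}"

fun walk_edges :: "'a list \<Rightarrow> 'a set list" where
  "walk_edges (x # y # xs) = {x, y} # walk_edges (y # xs)"
| "walk_edges _ = []"

definition path_between :: "'a set \<Rightarrow> 'a set set \<Rightarrow> 'a \<Rightarrow> 'a \<Rightarrow> 'a list \<Rightarrow> bool" where
  "path_between V E u v xs \<longleftrightarrow>
     xs \<noteq> [] \<and> hd xs = u \<and> last xs = v \<and> distinct xs \<and>
     set xs \<subseteq> V \<and> set (walk_edges xs) \<subseteq> E"

definition rainbow :: "('a set \<Rightarrow> 'b) \<Rightarrow> 'a list \<Rightarrow> bool" where
  "rainbow col xs \<longleftrightarrow> distinct (map col (walk_edges xs))"

definition rainbow_connected :: "'a set \<Rightarrow> 'a set set \<Rightarrow> ('a set \<Rightarrow> 'b) \<Rightarrow> bool" where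
  "rainbow_connected V E col \<longleftrightarrow>
     (\<forall>u\<in>V. \<forall>v\<in>V. u \<noteq> v \<longrightarrow> (\<exists>xs. path_between V E u v xs \<and> rainbow col xs))"

text \<open>The edge set of the binomial random graph on the vertex set \<open>{1..n}\<close>. Note that
  \<open>bernoulli_pmf\<close> truncates its parameter to the unit interval.\<close>

definition gnp :: "nat \<Rightarrow> real \<Rightarrow> nat set set pmf" where
  "gnp n p = map_pmf (\<lambda>f. {e \<in> complete_edges n. f e})
     (Pi_pmf (complete_edges n) False (\<lambda>_. bernoulli_pmf p))"

text \<open>Non-edges receive the dummy value \<open>0\<close>, which is not one of the colours \<open>1, \<dots>, s\<close>.\<close>

definition random_colouring :: "'a set set \<Rightarrow> nat \<Rightarrow> ('a set \<Rightarrow> nat) pmf" where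
  "random_colouring E s = Pi_pmf E 0 (\<lambda>_. pmf_of_set {1..s})"

definition coloured_gnp :: "nat \<Rightarrow> real \<Rightarrow> nat \<Rightarrow> (nat set set \<times> (nat set \<Rightarrow> nat)) pmf" where
  "coloured_gnp n p s =
     do { E \<leftarrow> gnp n p; col \<leftarrow> random_colouring E s; return_pmf (E, col) }"

end

theory Submission
  imports Defs "HOL-Real_Asymp.Real_Asymp"
begin

text \<open>
  Only paths of length exactly \<open>l\<close> are used, where \<open>l \<le> s\<close> is the given bound rounded up; a path
  with \<open>j\<close> colours extends along an edge in a new colour with probability at least
  \<open>p (1 - j / l)\<close>. Each vertex sends edges in linearly many (in \<open>l\<close>) distinct colours, with error
  probability \<open>o(1 / n)\<close>; here \<open>c > 1\<close> enters. Given this for \<open>u\<close> and \<open>v\<close>, expose a rainbow tree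
  of constant depth 5 from \<open>v\<close>. For each of its leaves \<open>y\<close>, with its set of five colours, grow a
  rainbow tree from \<open>u\<close> that avoids these colours, down to depth \<open>l - 6\<close>; Chernoff bounds control
  every level, with relative error \<open>1 / ln n\<close> except near the root. The edges between a leaf \<open>y\<close>
  and the last level of its tree are still unexposed and each of them completes a rainbow
  \<open>u\<close>-\<open>v\<close> path with probability at least \<open>p / l\<close>, so all of them fail with probability at most
  \<open>exp (- \<mu>)\<close>, where \<open>\<mu>\<close> is their number times \<open>p / l\<close>. From \<open>l! \<ge> (l / e) ^ l\<close> and
  \<open>(n p / e) ^ l \<ge> n (n p / e) powr (3 / 2)\<close> it follows that \<open>\<mu>\<close> is much larger than \<open>ln n\<close>,
  which allows a union bound over all pairs. Restricting to the five fixed colours of each leaf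
  separately keeps the \<open>u\<close>-trees of size at most \<open>n / (ln n) ^ 3\<close>, so that collisions are negligible.
\<close>

section \<open>Product distributions and deferred decisions\<close>

text \<open>Fubini: given the first coordinate \<open>g\<close>, the event has conditional
  probability at most 1 if \<open>g\<close> is bad and at most \<beta> otherwise; integrating over
  \<open>g\<close> adds the two contributions.\<close>

lemma prob_pair_pmf_le:
  assumes "\<And>g. \<not> bad g \<Longrightarrow> measure_pmf.prob N {h. Q g h} \<le> \<beta>" "\<beta> \<ge> 0"
  shows "measure_pmf.prob (pair_pmf M N) {(g, h). Q g h} \<le> measure_pmf.prob M {g. bad g} + \<beta>"
proof -
  have "emeasure (pair_pmf M N) {(g, h). Q g h}
      = (\<integral>\<^sup>+ g. emeasure (measure_pmf N) {h. Q g h} \<partial>measure_pmf M)"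
  proof -
    have "emeasure (measure_pmf N \<bind> (\<lambda>h. return (count_space UNIV) (g, h))) {(g, h). Q g h}
        = emeasure (measure_pmf N) {h. Q g h}" for g
    proof -
      have "emeasure (measure_pmf (bind_pmf N (\<lambda>h. return_pmf (g, h)))) {(g, h). Q g h}
         = emeasure (measure_pmf N) {h. Q g h}"
        unfolding map_pmf_def[symmetric] by (simp add: vimage_def)
      then show ?thesis by (simp add: measure_pmf_bind return_pmf.rep_eq)
    qed
    then show ?thesis unfolding pair_pmf_def map_pmf_def[symmetric]
      by (simp add: vimage_def)
  qed
  also have "\<dots> \<le> (\<integral>\<^sup>+ g. indicator {g. bad g} g + ennreal \<beta> \<partial>measure_pmf M)"
  proof (rule nn_integral_mono)
    fix g
    show "emeasure (measure_pmf N) {h. Q g h} \<le> indicator {g. bad g} g + ennreal \<beta>"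
    proof (cases "bad g")
      case True
      have "emeasure (measure_pmf N) {h. Q g h} \<le> 1"
        by (simp add: measure_pmf.emeasure_le_1)
      then show ?thesis using True by (simp add: add_increasing2)
    next
      case False
      then show ?thesis using assms(1)[OF False]
        by (simp add: measure_pmf.emeasure_eq_measure ennreal_leI)
    qed
  qed
  also have "\<dots> = emeasure (measure_pmf M) {g. bad g} + ennreal \<beta>"
    by (subst nn_integral_add) auto
  finally show ?thesis using assms(2)
    by (simp add: measure_pmf.emeasure_eq_measure flip: ennreal_plus)
qed

lemma prob_Pi_pmf_marginal:
  assumes "finite E" "E' \<subseteq> E" "\<And>f g. (\<And>e. e \<in> E' \<Longrightarrow> f e = g e) \<Longrightarrow> Q f \<longleftrightarrow> Q g"
  shows "measure_pmf.prob (Pi_pmf E d q) {f. Q f} = measure_pmf.prob (Pi_pmf E' d q) {f. Q f}"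
proof -
  have "Q (\<lambda>x. if x \<in> E' then f x else d) \<longleftrightarrow> Q f" for f
    by (rule assms(3)) simp
  then have "(\<lambda>f x. if x \<in> E' then f x else d) -` {f. Q f} = {f. Q f}"
    by simp
  then show ?thesis
    by (simp add: Pi_pmf_subset[OF assms(1,2)])
qed

text \<open>Deferred decisions: the coordinates in \<open>E1\<close> are exposed first.\<close>

lemma prob_Pi_pmf_split:
  assumes "finite E1" "finite E2" "E1 \<inter> E2 = {}"
  assumes "\<And>g. \<not> bad g \<Longrightarrow>
      measure_pmf.prob (Pi_pmf E2 d q) {h. Q (\<lambda>e. if e \<in> E1 then g e else h e)} \<le> \<beta>" "\<beta> \<ge> 0"
  shows "measure_pmf.prob (Pi_pmf (E1 \<union> E2) d q) {f. Q f}
      \<le> measure_pmf.prob (Pi_pmf E1 d q) {g. bad g} + \<beta>"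
proof -
  have "(\<lambda>(f, g) x. if x \<in> E1 then f x else g x) -` {f. Q f}
      = {(g, h). Q (\<lambda>e. if e \<in> E1 then g e else h e)}" by auto
  then show ?thesis
    using prob_pair_pmf_le[OF assms(4,5)] by (simp add: Pi_pmf_union[OF assms(1-3)])
qed

section \<open>Rainbow paths\<close>

lemma ex_subset_card: "n \<le> card S \<Longrightarrow> \<exists>T. T \<subseteq> S \<and> card T = n"
  by (rule obtain_subset_with_card_n) auto

definition pairs :: "'a set \<Rightarrow> 'a set set" where
  "pairs V = {e. e \<subseteq> V \<and> card e = 2}"

lemma finite_pairs [simp]: "finite V \<Longrightarrow> finite (pairs V)"
  by (rule finite_subset[of _ "Pow V"]) (auto simp: pairs_def)

lemma pairs_mono: "V \<subseteq> V' \<Longrightarrow> pairs V \<subseteq> pairs V'"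
  by (auto simp: pairs_def)

lemma pair_in_pairs: "x \<in> V \<Longrightarrow> y \<in> V \<Longrightarrow> x \<noteq> y \<Longrightarrow> {x, y} \<in> pairs V"
  by (auto simp: pairs_def)

text \<open>Colour \<open>0\<close> encodes an absent edge, so whenever \<open>0 \<in> F\<close> the edges of the path are present.\<close>

definition rpath :: "('a set \<Rightarrow> nat) \<Rightarrow> nat set \<Rightarrow> 'a set \<Rightarrow> 'a list \<Rightarrow> bool" where
  "rpath f F W zs \<longleftrightarrow> distinct zs \<and> set zs \<subseteq> W \<and>
     distinct (map f (walk_edges zs)) \<and> f ` set (walk_edges zs) \<inter> F = {}"

lemma rpath_single [simp]: "rpath f F W [x] \<longleftrightarrow> x \<in> W"
  by (simp add: rpath_def)

text \<open>Passing the colour of the first edge on to the forbidden set turns distinctness of the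
  colours into a recursion. Explorations rely on this form: the set kept at a tree vertex is the
  forbidden set for every continuation.\<close>

lemma rpath_Cons_Cons:
  "rpath f F W (x # y # zs) \<longleftrightarrow>
     x \<in> W \<and> x \<notin> set (y # zs) \<and> f {x, y} \<notin> F \<and> rpath f (insert (f {x, y}) F) W (y # zs)"
  by (auto simp: rpath_def)

lemma rpath_mono: "rpath f F W zs \<Longrightarrow> F' \<subseteq> F \<Longrightarrow> W \<subseteq> W' \<Longrightarrow> rpath f F' W' zs"
  by (auto simp: rpath_def)

lemma walk_edges_snoc:
  "zs \<noteq> [] \<Longrightarrow> walk_edges (zs @ [x]) = walk_edges zs @ [{last zs, x}]"
  by (induction zs rule: walk_edges.induct) auto

lemma walk_edges_rev: "walk_edges (rev zs) = rev (walk_edges zs)"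
proof (induction zs rule: walk_edges.induct)
  case (1 x y xs)
  then show ?case using walk_edges_snoc[of "rev xs @ [y]" x]
    by (simp add: insert_commute)
qed auto

lemma rpath_rev: "rpath f F W (rev zs) \<longleftrightarrow> rpath f F W zs"
  by (simp add: rpath_def walk_edges_rev flip: rev_map)

lemma walk_edges_subset_pairs: "distinct zs \<Longrightarrow> set zs \<subseteq> W \<Longrightarrow> set (walk_edges zs) \<subseteq> pairs W"
  by (induction zs rule: walk_edges.induct) (auto simp: pairs_def)

lemma rpath_cong:
  assumes "\<And>e. e \<in> pairs W \<Longrightarrow> f e = g e"
  shows "rpath f F W zs \<longleftrightarrow> rpath g F W zs"
proof (cases "distinct zs \<and> set zs \<subseteq> W")
  case True
  then have "\<And>e. e \<in> set (walk_edges zs) \<Longrightarrow> f e = g e"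
    using assms walk_edges_subset_pairs[of zs W] by blast
  then have "map f (walk_edges zs) = map g (walk_edges zs)"
    "f ` set (walk_edges zs) = g ` set (walk_edges zs)" by auto
  then show ?thesis by (simp only: rpath_def)
qed (auto simp: rpath_def)

lemma length_walk_edges: "length (walk_edges zs) = length zs - 1"
  by (induction zs rule: walk_edges.induct) auto

lemma rpath_snoc:
  assumes "rpath f (insert (f {last zs, x}) F) W zs" "zs \<noteq> []" "x \<in> W" "x \<notin> set zs" "f {last zs, x} \<notin> F"
  shows "rpath f F W (zs @ [x])"
  using assms by (auto simp: rpath_def walk_edges_snoc)

section \<open>Exposing one level\<close>

text \<open>In an exploration every \<open>F x\<close> contains \<open>0\<close>, so an absent edge
  never attaches a vertex. A vertex hit by several edges is counted once.\<close>

definition new_level :: "('a \<Rightarrow> nat set) \<Rightarrow> 'a set \<Rightarrow> 'a set \<Rightarrow> ('a set \<Rightarrow> nat) \<Rightarrow> 'a set" where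
  "new_level F T W f = {w \<in> W. \<exists>x\<in>T. f {x, w} \<notin> F x}"

lemma finite_new_level [simp]: "finite W \<Longrightarrow> finite (new_level F T W f)"
  by (simp add: new_level_def)

text \<open>The product \<open>(1 - x + x^2 / 2) * (1 + x + x^2 / 2)\<close> equals
  \<open>1 + x^4 / 4\<close>, hence is at least 1, and its second factor is at most
  \<open>exp x\<close>.\<close>

lemma exp_minus_le_quadratic:
  fixes x :: real
  assumes "0 \<le> x"
  shows "exp (- x) \<le> 1 - x + x\<^sup>2 / 2"
proof -
  have pos: "0 \<le> 1 - x + x\<^sup>2 / 2"
    using zero_le_power2[of "1 - x"] by (simp add: power2_eq_square algebra_simps)
  have "1 \<le> (1 - x + x\<^sup>2 / 2) * (1 + x + x\<^sup>2 / 2)"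
    using assms by (simp add: power2_eq_square algebra_simps)
  also have "\<dots> \<le> (1 - x + x\<^sup>2 / 2) * exp x"
    using exp_lower_Taylor_quadratic[OF assms] pos by (intro mult_left_mono) auto
  finally show ?thesis by (simp add: exp_minus field_simps)
qed

text \<open>\<open>q\<close> is the distribution of the state of one potential edge: absent (\<open>0\<close>) or its colour.\<close>

locale edge_model =
  fixes q :: "nat pmf" and p :: real and l :: nat
  assumes p_nonneg: "0 \<le> p" and p_le_1: "p \<le> 1" and l_pos: "0 < l"
    and avoid: "\<lbrakk>finite F; 0 \<in> F; card F \<le> Suc j; j \<le> l\<rbrakk>
      \<Longrightarrow> p * (1 - real j / real l) \<le> measure_pmf.prob q (- F)"
begin

abbreviation G :: "'a set set \<Rightarrow> ('a set \<Rightarrow> nat) pmf" where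
  "G E \<equiv> Pi_pmf E 0 (\<lambda>_. q)"

text \<open>Distinct edges are independent, so the probability is a product of factors at most
  \<open>1 - b\<close>. The index set is kept apart from the edges so that \<open>H\<close> may
  depend on how an edge arises, for instance on a leaf and an end vertex.\<close>

lemma prob_all_within:
  assumes "finite E" "k ` I \<subseteq> E" "inj_on k I" "\<And>i. i \<in> I \<Longrightarrow> b \<le> measure_pmf.prob q (- H i)"
  shows "measure_pmf.prob (G E) {f. \<forall>i\<in>I. f (k i) \<in> H i} \<le> (1 - b) ^ card I"
proof -
  define H' where "H' e = H (inv_into I k e)" for e
  have H': "H' (k i) = H i" if "i \<in> I" for i
    using that assms(3) by (simp add: H'_def)
  have fin: "finite (k ` I)" using assms finite_subset by blast
  have "measure_pmf.prob (G E) {f. \<forall>i\<in>I. f (k i) \<in> H i}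
      = measure_pmf.prob (G (k ` I)) {f. \<forall>i\<in>I. f (k i) \<in> H i}"
    by (rule prob_Pi_pmf_marginal) (use assms in auto)
  also have "\<dots> = measure_pmf.prob (G (k ` I)) (Pi (k ` I) H')"
    using H' by (intro arg_cong[where f = "measure_pmf.prob _"]) auto
  also have "measure_pmf.prob (G (k ` I)) (Pi (k ` I) H') = (\<Prod>e\<in>k ` I. measure_pmf.prob q (H' e))"
    using fin by (rule measure_Pi_pmf_Pi)
  also have "\<dots> \<le> (\<Prod>e\<in>k ` I. 1 - b)"
  proof (rule prod_mono)
    fix e assume "e \<in> k ` I"
    then have "b \<le> measure_pmf.prob q (- H' e)" using assms(4) H' by auto
    moreover have "measure_pmf.prob q (- H' e) = 1 - measure_pmf.prob q (H' e)"
      using measure_pmf.prob_compl[of "H' e" q] by (simp add: Compl_eq_Diff_UNIV)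
    ultimately show "0 \<le> measure_pmf.prob q (H' e) \<and> measure_pmf.prob q (H' e) \<le> 1 - b"
      by simp
  qed
  also have "\<dots> = (1 - b) ^ card I" using assms(3) by (simp add: card_image)
  finally show ?thesis .
qed

abbreviation star :: "'a set \<Rightarrow> 'a \<Rightarrow> 'a set set" where
  "star T w \<equiv> (\<lambda>x. {x, w}) ` T"

lemma star_hit_prob:
  assumes "finite T" "w \<notin> T" "\<And>x. x \<in> T \<Longrightarrow> b \<le> measure_pmf.prob q (- F x)"
  shows "measure_pmf.prob (G (star T w)) {f. \<forall>x\<in>T. f {x, w} \<in> F x} \<le> (1 - b) ^ card T"
proof -
  have "inj_on (\<lambda>x. {x, w}) T" using assms(2) by (auto simp: inj_on_def doubleton_eq_iff)
  then show ?thesis using assms by (intro prob_all_within) auto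
qed

text \<open>The stars from \<open>T\<close> to different vertices of \<open>W\<close> use disjoint
  sets of edges, so attachments are independent. Each further vertex multiplies the Laplace
  transform of the level size by at most \<open>1 - \<pi> * (1 - exp (- r))\<close>, where \<pi> is
  a lower bound for the probability of attachment.\<close>

lemma new_level_mgf:
  fixes r b :: real
  assumes "finite W" "finite T" "T \<inter> W = {}" "0 \<le> r" "0 \<le> b" "b \<le> 1"
    and "\<And>x. x \<in> T \<Longrightarrow> b \<le> measure_pmf.prob q (- F x)"
    and \<pi>: "\<pi> \<le> 1 - (1 - b) ^ card T"
  shows "(\<integral>\<^sup>+ f. ennreal (exp (- r * card (new_level F T W f))) \<partial>measure_pmf (G (\<Union>w\<in>W. star T w)))
     \<le> ennreal ((1 - \<pi> * (1 - exp (- r))) ^ card W)"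
  using assms(1,3)
proof (induction W rule: finite_induct)
  case empty
  then show ?case by (simp add: new_level_def)
next
  case (insert w W)
  let ?S = "\<Union>w\<in>W. star T w"
  let ?hit = "\<lambda>f. \<exists>x\<in>T. f {x, w} \<notin> F x"
  \<comment> \<open>\<open>?m\<close> glues a state of the star of the new vertex to a state of the
    remaining edges.\<close>
  let ?m = "\<lambda>f g x. if x \<in> star T w then f x else g x"
  have disj: "star T w \<inter> ?S = {}" using insert by (auto simp: doubleton_eq_iff)
  have fin: "finite (star T w)" "finite ?S" using insert assms by auto
  have pi1: "\<pi> \<le> 1"
  proof -
    have "0 \<le> (1 - b) ^ card T" using assms(6) by simp
    then show ?thesis using \<pi> by linarith
  qed
  have card: "card (new_level F T (insert w W) (?m f g)) =
     (of_bool (?hit f)) + card (new_level F T W g)" for f g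
  proof -
    have eq: "new_level F T W (?m f g) = new_level F T W g"
      unfolding new_level_def using disj by (intro Collect_cong conj_cong refl bex_cong) auto
    have hit: "?hit (?m f g) \<longleftrightarrow> ?hit f" by auto
    show ?thesis
    proof (cases "?hit f")
      case True
      then have "new_level F T (insert w W) (?m f g) = insert w (new_level F T W (?m f g))"
        using hit by (auto simp: new_level_def)
      moreover have "w \<notin> new_level F T W (?m f g)" using insert by (auto simp: new_level_def)
      ultimately show ?thesis using True insert(1) eq by simp
    next
      case False
      then have "new_level F T (insert w W) (?m f g) = new_level F T W (?m f g)"
        using hit by (auto simp: new_level_def)
      then show ?thesis using False eq by simp
    qed
  qed
  have one: "(\<integral>\<^sup>+ f. ennreal (exp (- r * of_bool (?hit f))) \<partial>measure_pmf (G (star T w)))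
     \<le> ennreal (1 - \<pi> * (1 - exp (- r)))"
  proof -
    \<comment> \<open>\<open>?N\<close> is the event that \<open>w\<close> is missed; the integrand
      is 1 there and \<open>exp (- r)\<close> elsewhere.\<close>
    let ?N = "{f. \<forall>x\<in>T. f {x, w} \<in> F x}"
    have "ennreal (exp (- r * of_bool (?hit f)))
        = ennreal (exp (- r)) + ennreal (1 - exp (- r)) * indicator ?N f" for f
      using assms(4) by (auto simp: indicator_def simp flip: ennreal_plus)
    then have "(\<integral>\<^sup>+ f. ennreal (exp (- r * of_bool (?hit f))) \<partial>measure_pmf (G (star T w)))
       = ennreal (exp (- r)) + ennreal (1 - exp (- r)) * emeasure (measure_pmf (G (star T w))) ?N"
      by (simp add: nn_integral_add nn_integral_cmult)
    also have "\<dots> = ennreal (exp (- r) + (1 - exp (- r)) * measure_pmf.prob (G (star T w)) ?N)"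
      using assms(4) by (simp add: measure_pmf.emeasure_eq_measure ennreal_plus ennreal_mult)
    also have "\<dots> \<le> ennreal (exp (- r) + (1 - exp (- r)) * (1 - \<pi>))"
    proof (rule ennreal_leI, rule add_left_mono, rule mult_left_mono)
      show "measure_pmf.prob (G (star T w)) ?N \<le> 1 - \<pi>"
        using star_hit_prob[of T w b F] assms insert.prems by fastforce
    qed (use assms(4) in simp)
    finally show ?thesis by (simp add: algebra_simps)
  qed
  have "(\<integral>\<^sup>+ f. ennreal (exp (- r * card (new_level F T (insert w W) f)))
          \<partial>measure_pmf (G (\<Union>w\<in>insert w W. star T w)))
     = (\<integral>\<^sup>+ f. (\<integral>\<^sup>+ g. ennreal (exp (- r * card (new_level F T (insert w W) (?m f g))))
          \<partial>measure_pmf (G ?S)) \<partial>measure_pmf (G (star T w)))"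
    by (simp add: Pi_pmf_union[OF fin disj] nn_integral_pair_pmf' case_prod_unfold cong: if_cong)
  also have "\<dots> = (\<integral>\<^sup>+ f. (\<integral>\<^sup>+ g. ennreal (exp (- r * of_bool (?hit f))) *
       ennreal (exp (- r * card (new_level F T W g)))
          \<partial>measure_pmf (G ?S)) \<partial>measure_pmf (G (star T w)))"
    unfolding card by (simp add: ring_distribs exp_add exp_diff ennreal_mult'[symmetric] exp_minus divide_inverse)
  also have "\<dots> = (\<integral>\<^sup>+ f. ennreal (exp (- r * of_bool (?hit f))) \<partial>measure_pmf (G (star T w))) *
      (\<integral>\<^sup>+ g. ennreal (exp (- r * card (new_level F T W g))) \<partial>measure_pmf (G ?S))"
    by (subst nn_integral_cmult, simp, subst nn_integral_multc) auto
  also have "\<dots> \<le> ennreal (1 - \<pi> * (1 - exp (- r))) * ennreal ((1 - \<pi> * (1 - exp (- r))) ^ card W)"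
    using insert by (intro mult_mono one) auto
  also have "\<dots> = ennreal ((1 - \<pi> * (1 - exp (- r))) ^ card (insert w W))"
  proof -
    have "\<pi> * (1 - exp (- r)) \<le> 1 * (1 - exp (- r))"
      using pi1 assms(4) by (intro mult_right_mono) auto
    then have "0 \<le> 1 - \<pi> * (1 - exp (- r))" by (smt (verit) exp_gt_zero)
    then show ?thesis using insert by (simp add: ennreal_mult)
  qed
  finally show ?case .
qed

text \<open>Exponential Markov inequality with parameter \<epsilon> itself; by
  \<open>exp_minus_le_quadratic\<close> this simple choice already gives the factor
  \<open>\<epsilon>^2 / 2\<close> in the exponent.\<close>

lemma new_level_chernoff:
  fixes \<epsilon> b :: real
  assumes "finite W" "finite T" "T \<inter> W = {}" "0 \<le> b" "b \<le> 1"
    and "\<And>x. x \<in> T \<Longrightarrow> b \<le> measure_pmf.prob q (- F x)"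
    and \<pi>: "\<pi> \<le> 1 - (1 - b) ^ card T" "0 \<le> \<pi>" and \<epsilon>: "0 \<le> \<epsilon>"
    and E: "finite E" "(\<Union>w\<in>W. star T w) \<subseteq> E"
  shows "measure_pmf.prob (G E) {f. real (card (new_level F T W f)) < (1 - \<epsilon>) * (\<pi> * card W)}
     \<le> exp (- (\<epsilon>\<^sup>2 * (\<pi> * card W) / 2))"
proof -
  define S where "S = (\<Union>w\<in>W. star T w)"
  define \<mu> where "\<mu> = \<pi> * card W"
  let ?c = "\<lambda>f. real (card (new_level F T W f))"
  have \<mu>0: "0 \<le> \<mu>" using \<pi> by (simp add: \<mu>_def)
  have pi1: "\<pi> \<le> 1"
  proof -
    have "0 \<le> (1 - b) ^ card T" using assms(5) by simp
    then show ?thesis using \<pi> by linarith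
  qed
  have loc: "new_level F T W f = new_level F T W g" if "\<And>e. e \<in> S \<Longrightarrow> f e = g e" for f g
    unfolding new_level_def using that by (intro Collect_cong conj_cong refl bex_cong arg_cong[of _ _ "\<lambda>c. c \<notin> _"]) (auto simp: S_def)
  have "measure_pmf.prob (G E) {f. ?c f < (1 - \<epsilon>) * \<mu>} = measure_pmf.prob (G S) {f. ?c f < (1 - \<epsilon>) * \<mu>}"
  proof (rule prob_Pi_pmf_marginal)
    show "S \<subseteq> E" using E by (simp add: S_def)
    show "?c f < (1 - \<epsilon>) * \<mu> \<longleftrightarrow> ?c g < (1 - \<epsilon>) * \<mu>" if "\<And>e. e \<in> S \<Longrightarrow> f e = g e" for f g
      using loc[OF that] by simp
  qed (use E in simp)
  also have "ennreal \<dots> = (\<integral>\<^sup>+ f. indicator {f. ?c f < (1 - \<epsilon>) * \<mu>} f \<partial>measure_pmf (G S))"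
    by (simp add: measure_pmf.emeasure_eq_measure)
  also have "\<dots> \<le> (\<integral>\<^sup>+ f. ennreal (exp (\<epsilon> * ((1 - \<epsilon>) * \<mu>))) * ennreal (exp (- \<epsilon> * ?c f)) \<partial>measure_pmf (G S))"
  proof (rule nn_integral_mono)
    fix f
    have "1 \<le> exp (\<epsilon> * ((1 - \<epsilon>) * \<mu>)) * exp (- \<epsilon> * ?c f)" if "?c f < (1 - \<epsilon>) * \<mu>"
    proof -
      have "\<epsilon> * ?c f \<le> \<epsilon> * ((1 - \<epsilon>) * \<mu>)" using that \<epsilon> by (intro mult_left_mono) auto
      then show ?thesis by (simp flip: exp_add)
    qed
    then show "indicator {f. ?c f < (1 - \<epsilon>) * \<mu>} f
        \<le> ennreal (exp (\<epsilon> * ((1 - \<epsilon>) * \<mu>))) * ennreal (exp (- \<epsilon> * ?c f))"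
      by (auto simp: indicator_def simp flip: ennreal_mult)
  qed
  also have "\<dots> = ennreal (exp (\<epsilon> * ((1 - \<epsilon>) * \<mu>))) * (\<integral>\<^sup>+ f. ennreal (exp (- \<epsilon> * ?c f)) \<partial>measure_pmf (G S))"
    by (rule nn_integral_cmult) simp
  also have "\<dots> \<le> ennreal (exp (\<epsilon> * ((1 - \<epsilon>) * \<mu>))) * ennreal ((1 - \<pi> * (1 - exp (- \<epsilon>))) ^ card W)"
    unfolding S_def using new_level_mgf[OF assms(1-3) \<epsilon> assms(4-6) \<pi>(1)] by (intro mult_left_mono) auto
  also have "\<dots> \<le> ennreal (exp (\<epsilon> * ((1 - \<epsilon>) * \<mu>)) * exp (- (\<mu> * (1 - exp (- \<epsilon>)))))"
  proof -
    have "\<pi> * (1 - exp (- \<epsilon>)) \<le> 1 * (1 - exp (- \<epsilon>))"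
      using pi1 \<epsilon> by (intro mult_right_mono) auto
    then have nn: "0 \<le> 1 - \<pi> * (1 - exp (- \<epsilon>))" by (smt (verit) exp_gt_zero)
    have "(1 - \<pi> * (1 - exp (- \<epsilon>))) ^ card W \<le> exp (- (\<pi> * (1 - exp (- \<epsilon>)))) ^ card W"
      using nn exp_ge_add_one_self[of "- (\<pi> * (1 - exp (- \<epsilon>)))"] by (intro power_mono) auto
    also have "\<dots> = exp (- (\<mu> * (1 - exp (- \<epsilon>))))"
      by (simp add: \<mu>_def flip: exp_of_nat_mult)
    finally show ?thesis using nn
      by (simp add: ennreal_leI mult_left_mono flip: ennreal_mult)
  qed
  finally have "measure_pmf.prob (G E) {f. ?c f < (1 - \<epsilon>) * \<mu>}
      \<le> exp (\<epsilon> * ((1 - \<epsilon>) * \<mu>)) * exp (- (\<mu> * (1 - exp (- \<epsilon>))))"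
    by (simp add: ennreal_le_iff)
  also have "\<dots> = exp (\<mu> * (\<epsilon> * (1 - \<epsilon>) - (1 - exp (- \<epsilon>))))"
    by (simp add: algebra_simps flip: exp_add)
  also have "\<dots> \<le> exp (\<mu> * (- (\<epsilon>\<^sup>2 / 2)))"
  proof -
    have "\<epsilon> * (1 - \<epsilon>) - (1 - exp (- \<epsilon>)) \<le> - (\<epsilon>\<^sup>2 / 2)"
      using exp_minus_le_quadratic[OF \<epsilon>] by (simp add: power2_eq_square algebra_simps)
    then show ?thesis using \<mu>0 by (simp only: exp_le_cancel_iff mult_left_mono)
  qed
  finally show ?thesis by (simp add: \<mu>_def algebra_simps)
qed

text \<open>The parameter \<tau> is spent twice. Since \<open>b * card T \<le> \<tau>\<close>,
  multiple hits lower the attachment probability only to \<open>b * card T * (1 - \<tau>)\<close>;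
  this loss is inside \<mu>. The factor in front of \<mu> is the Chernoff deviation.\<close>

lemma new_level_prob:
  fixes \<tau> :: real
  assumes "finite W" "finite T" "T \<inter> W = {}"
    and F: "\<And>x. x \<in> T \<Longrightarrow> finite (F x) \<and> 0 \<in> F x \<and> card (F x) \<le> Suc j"
    and "j \<le> l" and \<tau>: "0 \<le> \<tau>" "\<tau> \<le> 1" "p * card T \<le> \<tau>"
    and E: "finite E" "(\<Union>w\<in>W. star T w) \<subseteq> E"
    and \<mu>: "\<mu> = p * (1 - real j / l) * card T * (1 - \<tau>) * card W"
  shows "measure_pmf.prob (G E) {f. real (card (new_level F T W f)) < (1 - \<tau>) * \<mu>}
     \<le> exp (- (\<tau>\<^sup>2 * \<mu> / 2))"
proof -
  define b where "b = p * (1 - real j / l)"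
  define \<pi> where "\<pi> = b * card T * (1 - \<tau>)"
  have fr: "0 \<le> 1 - real j / l" "1 - real j / l \<le> 1" using assms(5) l_pos by (auto simp: field_simps)
  have b0: "0 \<le> b" using fr p_nonneg by (simp add: b_def)
  have bp: "b \<le> p" unfolding b_def using mult_left_mono[OF fr(2) p_nonneg] by simp
  have b1: "b \<le> 1" using bp p_le_1 by simp
  have bT: "b * card T \<le> \<tau>" using mult_right_mono[OF bp, of "card T"] \<tau> by simp
  have "(1 - b) ^ card T \<le> exp (- b) ^ card T"
    using b1 exp_ge_add_one_self[of "- b"] by (intro power_mono) auto
  also have "\<dots> = exp (- (b * card T))" by (simp flip: exp_of_nat_mult add: mult.commute)
  also have "\<dots> \<le> 1 - b * card T + (b * card T)\<^sup>2 / 2"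
    using b0 by (intro exp_minus_le_quadratic) auto
  also have "\<dots> \<le> 1 - \<pi>"
  proof -
    have "(b * card T)\<^sup>2 \<le> (b * card T) * \<tau>"
      unfolding power2_eq_square using bT b0 by (intro mult_left_mono) auto
    moreover have "0 \<le> (b * card T)\<^sup>2" by simp
    ultimately have "(b * card T)\<^sup>2 / 2 \<le> (b * card T) * \<tau>" by linarith
    then show ?thesis by (simp add: \<pi>_def algebra_simps)
  qed
  finally have \<pi>: "\<pi> \<le> 1 - (1 - b) ^ card T" by simp
  have \<pi>0: "0 \<le> \<pi>" using b0 \<tau> by (simp add: \<pi>_def)
  have av: "b \<le> measure_pmf.prob q (- F x)" if "x \<in> T" for x
    unfolding b_def using F[OF that] assms(5) by (intro avoid) auto
  from new_level_chernoff[OF assms(1-3) b0 b1 av \<pi> \<pi>0 \<tau>(1) E]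
  show ?thesis unfolding \<mu> \<pi>_def b_def by (simp add: mult.assoc)
qed

end

section \<open>Growing rainbow trees\<close>

text \<open>\<open>T\<close> is level \<open>i\<close> of an exploration, \<open>F x\<close> consists of \<open>0\<close>, the forbidden colours and the
  colours on the tree path to \<open>x\<close>, and \<open>W\<close> is the set of unexplored vertices. The last condition
  guarantees that at least \<open>w0\<close> of them remain after all \<open>r\<close> levels. The set \<open>A\<close> is left untouched.\<close>

definition exploration :: "(nat \<Rightarrow> nat) \<Rightarrow> nat \<Rightarrow> real \<Rightarrow> nat \<Rightarrow> 'a set \<Rightarrow> nat \<Rightarrow>
    'a set \<Rightarrow> ('a \<Rightarrow> nat set) \<Rightarrow> 'a set \<Rightarrow> bool" where
  "exploration m J w0 r A i T F W \<longleftrightarrow>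
     finite T \<and> finite W \<and> T \<inter> W = {} \<and> A \<inter> (T \<union> W) = {} \<and> card T = m i \<and>
     (\<forall>x\<in>T. finite (F x) \<and> 0 \<in> F x \<and> card (F x) \<le> Suc (J + i)) \<and>
     w0 + (\<Sum>j\<in>{i<..r}. real (m j)) \<le> real (card W)"

definition reach :: "('a set \<Rightarrow> nat) \<Rightarrow> 'a set \<Rightarrow> ('a \<Rightarrow> nat set) \<Rightarrow> 'a set \<Rightarrow> nat \<Rightarrow> 'a set" where
  "reach f T F W r = {w. \<exists>x\<in>T. \<exists>zs. length zs = r \<and> rpath f (F x) (insert x W) (x # zs) \<and> last (x # zs) = w}"

text \<open>\<open>\<alpha> x\<close> is the colour of the edge from \<open>x \<in> A\<close> to the target vertex.\<close>

definition completes :: "('a \<Rightarrow> nat) \<Rightarrow> 'a set \<Rightarrow> 'a set \<Rightarrow> ('a \<Rightarrow> nat set) \<Rightarrow> 'a set \<Rightarrow> ('a set \<Rightarrow> nat) \<Rightarrow> bool" where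
  "completes \<alpha> A T F W f \<longleftrightarrow> (\<exists>y\<in>T. \<exists>zs. zs \<noteq> [] \<and> last zs \<in> A \<and> \<alpha> (last zs) \<notin> F y \<and>
      rpath f (insert (\<alpha> (last zs)) (F y)) (insert y (W \<union> A)) (y # zs))"

context edge_model
begin

text \<open>A purely numerical condition on the planned sizes \<open>m i\<close>, so that it can be
  checked later without probability; \<eta> bounds the failure probability of one level. At most
  \<open>J\<close> colours besides \<open>0\<close> are forbidden at level 0, and \<open>w0\<close>
  bounds the number of unexplored vertices from below. The \<open>+ 1\<close> leaves room for
  rounding sizes up.\<close>

definition grows :: "(nat \<Rightarrow> nat) \<Rightarrow> nat \<Rightarrow> real \<Rightarrow> nat \<Rightarrow> real \<Rightarrow> bool" where
  "grows m J w0 r \<eta> \<longleftrightarrow> (\<forall>i<r. J + i \<le> l \<and> (\<exists>\<tau>. 0 \<le> \<tau> \<and> \<tau> \<le> 1 \<and> p * m i \<le> \<tau> \<and>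
     real (m (Suc i)) < (1 - \<tau>) * (p * (1 - real (J + i) / l) * m i * (1 - \<tau>) * w0) + 1 \<and>
     exp (- (\<tau>\<^sup>2 * (p * (1 - real (J + i) / l) * m i * (1 - \<tau>) * w0) / 2)) \<le> \<eta>))"

lemma grows_step:
  assumes "grows m J w0 r \<eta>" "i < r" "exploration m J w0 r A i T F W"
    and E: "finite E" "(\<Union>w\<in>W. star T w) \<subseteq> E"
  shows "measure_pmf.prob (G E) {f. card (new_level F T W f) < m (Suc i)} \<le> \<eta>"
proof -
  from assms(1,2) have J: "J + i \<le> l" unfolding grows_def by blast
  from assms(1,2) obtain \<tau> where \<tau>: "0 \<le> \<tau>" "\<tau> \<le> 1" "p * m i \<le> \<tau>"
    "real (m (Suc i)) < (1 - \<tau>) * (p * (1 - real (J + i) / l) * m i * (1 - \<tau>) * w0) + 1"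
    "exp (- (\<tau>\<^sup>2 * (p * (1 - real (J + i) / l) * m i * (1 - \<tau>) * w0) / 2)) \<le> \<eta>"
    unfolding grows_def by blast
  note st = assms(3)[unfolded exploration_def]
  define \<mu>0 where "\<mu>0 = p * (1 - real (J + i) / l) * m i * (1 - \<tau>) * w0"
  define \<mu> where "\<mu> = p * (1 - real (J + i) / l) * card T * (1 - \<tau>) * card W"
  have w: "w0 \<le> real (card W)"
    using st sum_nonneg[of "{i<..r}" "\<lambda>j. real (m j)"] by linarith
  have "real (J + i) / l \<le> 1" using J l_pos by (simp add: divide_le_eq)
  then have "\<mu>0 \<le> \<mu>" unfolding \<mu>0_def \<mu>_def using w st p_nonneg \<tau>(1,2)
    by (auto intro!: mult_left_mono)
  have "measure_pmf.prob (G E) {f. card (new_level F T W f) < m (Suc i)}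
     \<le> measure_pmf.prob (G E) {f. real (card (new_level F T W f)) < (1 - \<tau>) * \<mu>}"
  proof (rule measure_pmf.finite_measure_mono)
    \<comment> \<open>A level below the integer \<open>m (Suc i)\<close> misses it by at least one,
      which absorbs the \<open>+ 1\<close> in \<open>grows\<close>.\<close>
    have "(1 - \<tau>) * \<mu>0 \<le> (1 - \<tau>) * \<mu>" using \<open>\<mu>0 \<le> \<mu>\<close> \<tau> by (intro mult_left_mono) auto
    then show "{f. card (new_level F T W f) < m (Suc i)} \<subseteq> {f. real (card (new_level F T W f)) < (1 - \<tau>) * \<mu>}"
      using \<tau>(4) unfolding \<mu>0_def[symmetric] by (auto simp: Suc_le_eq[symmetric])
  qed simp
  also have "\<dots> \<le> exp (- (\<tau>\<^sup>2 * \<mu> / 2))"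
    by (rule new_level_prob[where j = "J + i"]) (use st J \<tau> E \<mu>_def in auto)
  also have "\<dots> \<le> exp (- (\<tau>\<^sup>2 * \<mu>0 / 2))"
    using \<open>\<mu>0 \<le> \<mu>\<close> by (simp add: mult_left_mono)
  also have "\<dots> \<le> \<eta>" using \<tau>(5) by (simp add: \<mu>0_def)
  finally show ?thesis .
qed

text \<open>Induction over the levels: expose the edges meeting \<open>T\<close>, keep exactly
  \<open>m (Suc i)\<close> attached vertices as \<open>T'\<close>, and continue with the other
  edges, which are still independent. \<open>Succ\<close> is abstract because the scheme serves both
  the trees from \<open>u\<close> (\<open>reach_prob\<close>) and the tree from \<open>v\<close>
  (\<open>completes_prob\<close>): \<open>propagate\<close> carries success back by one level,
  \<open>local\<close> confines it to the edges still in play, and \<open>base\<close> treats the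
  last level.\<close>

lemma growth:
  fixes Succ :: "nat \<Rightarrow> 'a set \<Rightarrow> ('a \<Rightarrow> nat set) \<Rightarrow> 'a set \<Rightarrow> ('a set \<Rightarrow> nat) \<Rightarrow> bool"
  assumes gr: "grows m J w0 r \<eta>" and "0 \<le> \<beta>" "0 \<le> \<eta>"
    and propagate: "\<And>i T F W T' F' f. \<lbrakk>i < r; exploration m J w0 r A i T F W; T' \<subseteq> W;
        \<And>w. w \<in> T' \<Longrightarrow> \<exists>x\<in>T. f {x, w} \<notin> F x \<and> F' w = insert (f {x, w}) (F x);
        Succ (Suc i) T' F' (W - T') f\<rbrakk> \<Longrightarrow> Succ i T F W f"
    and local: "\<And>i T F W f g. \<lbrakk>\<And>e. e \<in> pairs (T \<union> W \<union> A) \<Longrightarrow> f e = g e; Succ i T F W f\<rbrakk> \<Longrightarrow> Succ i T F W g"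
    and base: "\<And>T F W E. \<lbrakk>exploration m J w0 r A r T F W; finite E; pairs (T \<union> W \<union> A) \<subseteq> E\<rbrakk>
       \<Longrightarrow> measure_pmf.prob (G E) {f. \<not> Succ r T F W f} \<le> \<beta>"
  shows "i \<le> r \<Longrightarrow> exploration m J w0 r A i T F W \<Longrightarrow> finite E \<Longrightarrow> pairs (T \<union> W \<union> A) \<subseteq> E \<Longrightarrow>
    measure_pmf.prob (G E) {f. \<not> Succ i T F W f} \<le> real (r - i) * \<eta> + \<beta>"
proof (induction "r - i" arbitrary: i T F W E)
  case 0
  then show ?case using base by auto
next
  case (Suc k)
  then have ir: "i < r" by simp
  note st = Suc.prems(2)[unfolded exploration_def]
  \<comment> \<open>\<open>E1\<close> takes all edges that meet \<open>T\<close>, also those inside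
    \<open>T\<close> or to \<open>A\<close>; everything that later levels look at lies in
    \<open>E2\<close>.\<close>
  define E1 where "E1 = {e \<in> E. e \<inter> T \<noteq> {}}"
  define E2 where "E2 = {e \<in> E. e \<inter> T = {}}"
  have fin: "finite E1" "finite E2" "E1 \<inter> E2 = {}" and EE: "E = E1 \<union> E2"
    using Suc.prems(3) by (auto simp: E1_def E2_def)
  have TW1: "{x, w} \<in> E1" if "x \<in> T" "w \<in> W" for x w
  proof -
    have "x \<noteq> w" using that st by auto
    then have "{x, w} \<in> E" using that pair_in_pairs[of x "T \<union> W \<union> A" w] Suc.prems(4) by auto
    then show ?thesis using that by (auto simp: E1_def)
  qed
  have \<beta>': "0 \<le> real (r - Suc i) * \<eta> + \<beta>" using assms(2,3) by simp
  let ?bad = "\<lambda>g. card (new_level F T W g) < m (Suc i)"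
  have "measure_pmf.prob (G E) {f. \<not> Succ i T F W f}
      \<le> measure_pmf.prob (G E1) {g. ?bad g} + (real (r - Suc i) * \<eta> + \<beta>)"
    unfolding EE
  proof (rule prob_Pi_pmf_split[OF fin _ \<beta>'])
    fix g assume "\<not> ?bad g"
    then obtain T' where T': "T' \<subseteq> new_level F T W g" "card T' = m (Suc i)"
      using ex_subset_card[of "m (Suc i)" "new_level F T W g"] by (auto simp: not_less)
    then have T'W: "T' \<subseteq> W" by (auto simp: new_level_def)
    have "\<forall>w\<in>T'. \<exists>x. x \<in> T \<and> g {x, w} \<notin> F x" using T' by (auto simp: new_level_def)
    \<comment> \<open>One parent per new vertex fixes its tree path and hence its colour set
      \<open>F'\<close>, which grows by at most one element.\<close>
    then obtain par where par: "\<And>w. w \<in> T' \<Longrightarrow> par w \<in> T \<and> g {par w, w} \<notin> F (par w)"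
      by metis
    define F' where "F' w = insert (g {par w, w}) (F (par w))" for w
    have finT': "finite T'" using T'W st finite_subset by blast
    have st': "exploration m J w0 r A (Suc i) T' F' (W - T')"
      unfolding exploration_def
    proof (intro conjI ballI)
      show "finite T'" by fact
      show "finite (W - T')" using st by simp
      show "A \<inter> (T' \<union> (W - T')) = {}" using st T'W by auto
      show "card T' = m (Suc i)" by fact
      fix w assume w: "w \<in> T'"
      show "finite (F' w)" "0 \<in> F' w" using par[OF w] st unfolding F'_def by blast+
      have "par w \<in> T" using par[OF w] by simp
      then have "card (F (par w)) \<le> Suc (J + i)" "finite (F (par w))" using st by blast+
      then show "card (F' w) \<le> Suc (J + Suc i)"
        unfolding F'_def by (simp add: card_insert_if)
    next
      \<comment> \<open>The vertices of \<open>T'\<close> leave \<open>W\<close>; their number is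
        exactly the summand for \<open>Suc i\<close>, which need not be reserved any longer.\<close>
      have "{i<..r} = insert (Suc i) {Suc i<..r}" using ir by auto
      moreover have "card (W - T') = card W - card T'" "card T' \<le> card W"
        using T'W st finT' by (auto simp: card_Diff_subset card_mono)
      ultimately show "w0 + (\<Sum>j\<in>{Suc i<..r}. real (m j)) \<le> real (card (W - T'))"
        using st T'(2) by simp
    qed auto
    have sub: "pairs (T' \<union> (W - T') \<union> A) \<subseteq> E2"
    proof
      fix e assume "e \<in> pairs (T' \<union> (W - T') \<union> A)"
      then have e: "e \<in> pairs (W \<union> A)" using T'W by (auto simp: pairs_def)
      then have "e \<in> E" using Suc.prems(4) pairs_mono[of "W \<union> A" "T \<union> W \<union> A"] by auto
      moreover have "e \<inter> T = {}" using e st by (auto simp: pairs_def)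
      ultimately show "e \<in> E2" by (simp add: E2_def)
    qed
    have "measure_pmf.prob (G E2) {h. \<not> Succ i T F W (\<lambda>e. if e \<in> E1 then g e else h e)}
        \<le> measure_pmf.prob (G E2) {h. \<not> Succ (Suc i) T' F' (W - T') h}"
    proof (rule measure_pmf.finite_measure_mono, intro Collect_mono impI)
      fix h assume *: "\<not> Succ i T F W (\<lambda>e. if e \<in> E1 then g e else h e)"
      show "\<not> Succ (Suc i) T' F' (W - T') h"
      proof
        assume "Succ (Suc i) T' F' (W - T') h"
        then have "Succ (Suc i) T' F' (W - T') (\<lambda>e. if e \<in> E1 then g e else h e)"
          by (rule local[rotated]) (use sub fin(3) in auto)
        then have "Succ i T F W (\<lambda>e. if e \<in> E1 then g e else h e)"
        proof (rule propagate[OF ir Suc.prems(2) T'W, rotated])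
          fix w assume w: "w \<in> T'"
          then show "\<exists>x\<in>T. (if {x, w} \<in> E1 then g {x, w} else h {x, w}) \<notin> F x \<and>
             F' w = insert (if {x, w} \<in> E1 then g {x, w} else h {x, w}) (F x)"
            using par[OF w] TW1[of "par w" w] T'W by (intro bexI[of _ "par w"]) (auto simp: F'_def)
        qed
        with * show False by simp
      qed
    qed simp
    also have "\<dots> \<le> real (r - Suc i) * \<eta> + \<beta>"
      by (rule Suc.hyps(1)) (use Suc.hyps(2) st' fin sub ir in auto)
    finally show "measure_pmf.prob (G E2) {h. \<not> Succ i T F W (\<lambda>e. if e \<in> E1 then g e else h e)}
       \<le> real (r - Suc i) * \<eta> + \<beta>" .
  qed
  also have "measure_pmf.prob (G E1) {g. ?bad g} \<le> \<eta>"
    by (rule grows_step[OF gr ir Suc.prems(2) fin(1)]) (use TW1 in auto)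
  also have "\<eta> + (real (r - Suc i) * \<eta> + \<beta>) = real (r - i) * \<eta> + \<beta>"
    using ir by (simp add: of_nat_diff algebra_simps)
  finally show ?case by simp
qed

text \<open>This is \<open>growth\<close> with empty \<open>A\<close> and \<beta> equal to 0: at
  depth \<open>r\<close> the reached set is the level itself, so nothing can fail there.\<close>

lemma reach_prob:
  assumes gr: "grows m J w0 r \<eta>" and "0 \<le> \<eta>"
    and st: "exploration m J w0 r {} 0 T F W" and E: "finite E" "pairs (T \<union> W) \<subseteq> E"
  shows "measure_pmf.prob (G E) {f. card (reach f T F W r) < m r} \<le> real r * \<eta>"
proof -
  define Succ where "Succ i T F W f \<longleftrightarrow> m r \<le> card (reach f T F W (r - i))" for i f and T W :: "'a set" and F
  have "measure_pmf.prob (G E) {f. \<not> Succ 0 T F W f} \<le> real (r - 0) * \<eta> + 0"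
  proof (rule growth[OF gr _ assms(2), where A = "{}"])
    show "exploration m J w0 r {} 0 T F W" by fact
    show "pairs (T \<union> W \<union> {}) \<subseteq> E" using E by simp
  next
    fix i T F W T' F' f
    assume *: "i < r" "exploration m J w0 r {} i T F W" "T' \<subseteq> W"
      "\<And>w. w \<in> T' \<Longrightarrow> \<exists>x\<in>T. f {x, w} \<notin> F x \<and> F' w = insert (f {x, w}) (F x)"
      "Succ (Suc i) T' F' (W - T') f"
    have "reach f T' F' (W - T') (r - Suc i) \<subseteq> reach f T F W (r - i)"
    proof
      fix z assume "z \<in> reach f T' F' (W - T') (r - Suc i)"
      then obtain w zs where w: "w \<in> T'" "length zs = r - Suc i"
        "rpath f (F' w) (insert w (W - T')) (w # zs)" "last (w # zs) = z"
        by (auto simp: reach_def)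
      obtain x where x: "x \<in> T" "f {x, w} \<notin> F x" "F' w = insert (f {x, w}) (F x)"
        using *(4)[OF w(1)] by blast
      have "set (w # zs) \<subseteq> W" using w(1,3) *(3) by (auto simp: rpath_def)
      then have "x \<notin> set (w # zs)" using x(1) *(2) by (auto simp: exploration_def)
      moreover have "rpath f (insert (f {x, w}) (F x)) (insert x W) (w # zs)"
        using rpath_mono[OF w(3), of "F' w" "insert x W"] x *(3) w(1) by auto
      ultimately have "rpath f (F x) (insert x W) (x # w # zs)"
        using x by (simp add: rpath_Cons_Cons)
      then show "z \<in> reach f T F W (r - i)" unfolding reach_def
        using x(1) w(2,4) *(1) by (intro CollectI bexI[of _ x] exI[of _ "w # zs"]) auto
    qed
    moreover have "finite (reach f T F W (r - i))"
    proof (rule finite_subset)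
      show "reach f T F W (r - i) \<subseteq> T \<union> W"
      proof
        fix z assume "z \<in> reach f T F W (r - i)"
        then obtain x zs where "x \<in> T" "set (x # zs) \<subseteq> insert x W" "last (x # zs) = z"
          by (auto simp: reach_def rpath_def)
        then show "z \<in> T \<union> W" using last_in_set[of "x # zs"] by auto
      qed
    qed (use *(2) in \<open>auto simp: exploration_def\<close>)
    ultimately show "Succ i T F W f" using *(5) unfolding Succ_def
      by (meson card_mono order_trans)
  next
    fix i T F W f g
    assume *: "\<And>e. e \<in> pairs (T \<union> W \<union> {}) \<Longrightarrow> f e = g e" "Succ i T F W f"
    have "rpath f (F x) (insert x W) zs \<longleftrightarrow> rpath g (F x) (insert x W) zs" if "x \<in> T" for x zs
      by (rule rpath_cong, rule *(1)) (use that pairs_mono[of "insert x W" "T \<union> W \<union> {}"] in auto)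
    then have "reach f T F W (r - i) = reach g T F W (r - i)"
      unfolding reach_def by auto
    then show "Succ i T F W g" using *(2) by (simp add: Succ_def)
  next
    fix T W :: "'a set" and F and E :: "'a set set"
    assume st: "exploration m J w0 r {} r T F W"
    have "reach f T F W (r - r) = T" for f by (auto simp: reach_def)
    then show "measure_pmf.prob (G E) {f. \<not> Succ r T F W f} \<le> 0"
      using st by (simp add: Succ_def exploration_def)
  qed (use E in auto)
  then show ?thesis by (simp add: Succ_def not_le)
qed


section \<open>Connecting the leaves of the tree from \<open>v\<close> to the trees from
  \<open>u\<close>\<close>

text \<open>Here \<open>S\<close> is the last level of the tree from \<open>v\<close>, and
  \<open>A\<close> consists of neighbours of \<open>u\<close>. First the edges avoiding
  \<open>S\<close> are exposed: each leaf \<open>y\<close> gets its own tree from \<open>A\<close>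
  that avoids \<open>F y\<close>, and a union bound over \<open>y\<close> suffices although these
  trees share edges. The edges at \<open>S\<close> are still fresh, so the connecting edges from the
  leaves to their last levels fail independently.\<close>

lemma completes_base:
  assumes gr: "grows m (Suc k) w0 r \<eta>" and "0 \<le> \<eta>" and l: "Suc (Suc k + r) \<le> l"
    and fin: "finite S" "finite W" "finite A"
    and disj: "S \<inter> W = {}" "A \<inter> (S \<union> W) = {}"
    and F: "\<And>y. y \<in> S \<Longrightarrow> finite (F y) \<and> 0 \<in> F y \<and> card (F y) \<le> Suc k"
    and inj: "inj_on \<alpha> A" and m0: "m 0 + Suc k \<le> card A"
    and W: "w0 + (\<Sum>j\<in>{0<..r}. real (m j)) \<le> real (card W)"
    and E: "finite E" "pairs (S \<union> W \<union> A) \<subseteq> E"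
  shows "measure_pmf.prob (G E) {f. \<not> completes \<alpha> A S F W f}
     \<le> real (card S) * (real r * \<eta>) + (1 - p / l) ^ (card S * m r)"
proof -
  have "\<exists>T. T \<subseteq> {x \<in> A. \<alpha> x \<notin> F y} \<and> card T = m 0" if y: "y \<in> S" for y
  proof -
    \<comment> \<open>The colours \<alpha> are distinct on \<open>A\<close>, so each element of
      \<open>F y\<close> excludes at most one starting point.\<close>
    have "card {x \<in> A. \<alpha> x \<in> F y} = card (\<alpha> ` {x \<in> A. \<alpha> x \<in> F y})"
      using inj by (intro card_image[symmetric]) (auto simp: inj_on_def)
    also have "\<dots> \<le> card (F y)" using F[OF y] by (intro card_mono) auto
    also have "\<dots> \<le> Suc k" using F[OF y] by simp
    finally have "card {x \<in> A. \<alpha> x \<in> F y} \<le> Suc k" .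
    moreover have "card A = card {x \<in> A. \<alpha> x \<in> F y} + card {x \<in> A. \<alpha> x \<notin> F y}"
      using fin(3) card_Un_disjoint[of "{x \<in> A. \<alpha> x \<in> F y}" "{x \<in> A. \<alpha> x \<notin> F y}"]
      by (simp add: Int_def Un_def conj_disj_distribL[symmetric] cong: conj_cong)
    ultimately have "m 0 \<le> card {x \<in> A. \<alpha> x \<notin> F y}" using m0 by simp
    then show ?thesis by (rule ex_subset_card)
  qed
  then obtain A' where A': "\<And>y. y \<in> S \<Longrightarrow> A' y \<subseteq> {x \<in> A. \<alpha> x \<notin> F y} \<and> card (A' y) = m 0"
    by metis
  define F2 where "F2 y x = insert (\<alpha> x) (F y)" for x y
  have st: "exploration m (Suc k) w0 r {} 0 (A' y) (F2 y) W" if y: "y \<in> S" for y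
    unfolding exploration_def
  proof (intro conjI ballI)
    show "finite (A' y)" using A'[OF y] fin(3) finite_subset[of "A' y" A] by blast
    show "A' y \<inter> W = {}" using A'[OF y] disj by auto
    show "w0 + (\<Sum>j\<in>{0<..r}. real (m j)) \<le> real (card W)" by (rule W)
    fix x assume "x \<in> A' y"
    show "card (F2 y x) \<le> Suc (Suc k + 0)" using F[OF y] by (simp add: F2_def card_insert_if)
  qed (use A'[OF y] fin F[OF y] in \<open>auto simp: F2_def\<close>)
  define E1 where "E1 = {e \<in> E. e \<inter> S = {}}"
  define E2 where "E2 = {e \<in> E. e \<inter> S \<noteq> {}}"
  have finE: "finite E1" "finite E2" "E1 \<inter> E2 = {}" and EE: "E = E1 \<union> E2"
    using E(1) by (auto simp: E1_def E2_def)
  have sub1: "pairs (W \<union> A) \<subseteq> E1"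
  proof
    fix e assume e: "e \<in> pairs (W \<union> A)"
    then have "e \<in> E" using E(2) pairs_mono[of "W \<union> A" "S \<union> W \<union> A"] by auto
    moreover have "e \<inter> S = {}" using e disj by (auto simp: pairs_def)
    ultimately show "e \<in> E1" by (simp add: E1_def)
  qed
  define bad where "bad g \<longleftrightarrow> (\<exists>y\<in>S. card (reach g (A' y) (F2 y) W r) < m r)" for g
  have nn: "0 \<le> (1 - p / l) ^ (card S * m r)"
  proof -
    have "p / l \<le> 1" using p_le_1 l_pos by (simp add: divide_le_eq)
    then show ?thesis by simp
  qed
  have "measure_pmf.prob (G E) {f. \<not> completes \<alpha> A S F W f}
     \<le> measure_pmf.prob (G E1) {g. bad g} + (1 - p / l) ^ (card S * m r)"
    unfolding EE
  proof (rule prob_Pi_pmf_split[OF finE _ nn])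
    fix g assume "\<not> bad g"
    then have "\<exists>X. X \<subseteq> reach g (A' y) (F2 y) W r \<and> card X = m r" if "y \<in> S" for y
      using that ex_subset_card[of "m r" "reach g (A' y) (F2 y) W r"] by (auto simp: bad_def not_less)
    then obtain X where X: "\<And>y. y \<in> S \<Longrightarrow> X y \<subseteq> reach g (A' y) (F2 y) W r \<and> card (X y) = m r"
      by metis
    \<comment> \<open>The tree path runs from \<open>A\<close> to \<open>w\<close>; reversed, it can
      be prefixed by \<open>y\<close>.\<close>
    have "\<exists>zs. length zs = Suc r \<and> last zs \<in> A' y \<and> hd zs = w \<and> rpath g (F2 y (last zs)) (W \<union> A) zs"
      if "y \<in> S" "w \<in> X y" for y w
    proof -
      have "w \<in> reach g (A' y) (F2 y) W r" using X[OF that(1)] that(2) by auto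
      then obtain x zs where x: "x \<in> A' y" "length zs = r"
        "rpath g (F2 y x) (insert x W) (x # zs)" "last (x # zs) = w"
        by (auto simp: reach_def)
      have "rpath g (F2 y x) (W \<union> A) (rev (x # zs))"
        unfolding rpath_rev by (rule rpath_mono[OF x(3)]) (use x(1) A'[OF that(1)] in auto)
      moreover have "hd (rev (x # zs)) = w" using x(4) by (simp only: hd_rev)
      ultimately show ?thesis using x by (intro exI[of _ "rev (x # zs)"]) auto
    qed
    then obtain Z where Z: "\<And>y w. y \<in> S \<Longrightarrow> w \<in> X y \<Longrightarrow> length (Z y w) = Suc r \<and>
       last (Z y w) \<in> A' y \<and> hd (Z y w) = w \<and> rpath g (F2 y (last (Z y w))) (W \<union> A) (Z y w)"
      by metis
    \<comment> \<open>The states of \<open>{y, w}\<close> that do not help: absent, a colour on the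
      tree path to \<open>y\<close>, the colour of the edge at \<open>u\<close>, or a colour on the
      path from \<open>w\<close> to \<open>A\<close>.\<close>
    define H where "H = (\<lambda>(y, w). F2 y (last (Z y w)) \<union> g ` set (walk_edges (Z y w)))"
    have XWA: "w \<in> W \<union> A" if "y \<in> S" "w \<in> X y" for y w
      using Z[OF that] unfolding rpath_def by (metis hd_in_set length_0_conv nat.distinct(1) subsetD)
    have "measure_pmf.prob (G E2) {h. \<not> completes \<alpha> A S F W (\<lambda>e. if e \<in> E1 then g e else h e)}
      \<le> measure_pmf.prob (G E2) {h. \<forall>i\<in>Sigma S X. h ((\<lambda>(y, w). {y, w}) i) \<in> H i}"
    proof (rule measure_pmf.finite_measure_mono, intro Collect_mono impI, rule ccontr)
      fix h
      let ?f = "\<lambda>e. if e \<in> E1 then g e else h e"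
      assume no: "\<not> completes \<alpha> A S F W ?f"
      assume "\<not> (\<forall>i\<in>Sigma S X. h ((\<lambda>(y, w). {y, w}) i) \<in> H i)"
      then obtain y w where yw: "y \<in> S" "w \<in> X y" "h {y, w} \<notin> H (y, w)" by auto
      note z = Z[OF yw(1,2)]
      obtain zs where zs: "Z y w = w # zs" using z by (cases "Z y w") auto
      define x where "x = last (w # zs)"
      have xA: "x \<in> A" "\<alpha> x \<notin> F y" using z A'[OF yw(1)] zs by (auto simp: x_def)
      have fe: "?f {y, w} = h {y, w}" using yw(1) by (auto simp: E1_def)
      have "y \<notin> W \<union> A" using yw(1) disj by auto
      have "rpath ?f (F2 y x) (W \<union> A) (w # zs) \<longleftrightarrow> rpath g (F2 y x) (W \<union> A) (w # zs)"
        by (rule rpath_cong) (use sub1 in auto)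
      then have rp: "rpath ?f (F2 y x) (W \<union> A) (w # zs)" using z zs by (simp add: x_def)
      have "set (walk_edges (w # zs)) \<subseteq> pairs (W \<union> A)"
        using rp by (intro walk_edges_subset_pairs) (auto simp: rpath_def)
      then have cols: "?f ` set (walk_edges (w # zs)) = g ` set (walk_edges (w # zs))"
        using sub1 by (intro image_cong) auto
      have hn: "h {y, w} \<notin> F2 y x" "h {y, w} \<notin> g ` set (walk_edges (w # zs))"
        using yw(3) zs by (auto simp: H_def x_def)
      have "rpath ?f (insert (?f {y, w}) (F2 y x)) (insert y (W \<union> A)) (w # zs)"
        using rp hn(2) unfolding rpath_def cols fe by auto
      moreover have "y \<notin> set (w # zs)" using rp \<open>y \<notin> W \<union> A\<close> by (auto simp: rpath_def)
      ultimately have "rpath ?f (F2 y x) (insert y (W \<union> A)) (y # w # zs)"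
        using hn(1) fe unfolding rpath_Cons_Cons by simp
      then have "completes \<alpha> A S F W ?f"
        unfolding completes_def using yw(1) xA unfolding F2_def x_def
        by (intro bexI[of _ y] exI[of _ "w # zs"]) auto
      with no show False by simp
    qed simp
    also have "\<dots> \<le> (1 - p / l) ^ card (Sigma S X)"
    proof (rule prob_all_within[OF finE(2)])
      show "(\<lambda>(y, w). {y, w}) ` Sigma S X \<subseteq> E2"
      proof clarify
        fix y w assume yw: "y \<in> S" "w \<in> X y"
        then have "{y, w} \<in> pairs (S \<union> W \<union> A)" using XWA[OF yw] disj by (intro pair_in_pairs) auto
        then show "{y, w} \<in> E2" using E(2) yw(1) by (auto simp: E2_def)
      qed
      \<comment> \<open>Leaves lie in \<open>S\<close> and ends outside \<open>S\<close>, so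
        distinct pairs give distinct edges even where the last levels of different leaves
        overlap.\<close>
      show "inj_on (\<lambda>(y, w). {y, w}) (Sigma S X)"
      proof (rule inj_onI, clarify)
        fix y w y' w'
        assume *: "y \<in> S" "w \<in> X y" "y' \<in> S" "w' \<in> X y'" "{y, w} = {y', w'}"
        have "w \<notin> S" "w' \<notin> S" using XWA *(1-4) disj by blast+
        then show "y = y' \<and> w = w'" using * by (metis doubleton_eq_iff)
      qed
      fix i assume "i \<in> Sigma S X"
      then obtain y w where i: "i = (y, w)" "y \<in> S" "w \<in> X y" by auto
      note z = Z[OF i(2,3)]
      \<comment> \<open>At most \<open>k + 2\<close> elements of \<open>H i\<close> come from
        \<open>F2\<close>, which includes \<open>0\<close>, and at most \<open>r\<close> from the
        path. So \<open>H i\<close> has at most \<open>l\<close> elements, and \<open>avoid\<close>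
        with \<open>j = l - 1\<close> yields \<open>p / l\<close>.\<close>
      have "card (g ` set (walk_edges (Z y w))) \<le> r"
        using card_image_le[of "set (walk_edges (Z y w))" g] card_length[of "walk_edges (Z y w)"] z
        by (simp add: length_walk_edges)
      moreover have "card (F2 y (last (Z y w))) \<le> Suc (Suc k)"
        using F[OF i(2)] by (simp add: F2_def card_insert_if)
      ultimately have "card (H i) \<le> Suc (l - 1)"
        using card_Un_le[of "F2 y (last (Z y w))" "g ` set (walk_edges (Z y w))"] l
        by (simp add: H_def i)
      then have "p * (1 - real (l - 1) / l) \<le> measure_pmf.prob q (- H i)"
        using F[OF i(2)] by (intro avoid) (auto simp: H_def i F2_def)
      moreover have "p * (1 - real (l - 1) / l) = p / l"
        using l_pos by (simp add: field_simps of_nat_diff)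
      ultimately show "p / l \<le> measure_pmf.prob q (- H i)" by simp
    qed
    also have "card (Sigma S X) = card S * m r"
    proof -
      have "finite (X y)" if "y \<in> S" for y
        using XWA[OF that] fin by (intro finite_subset[of "X y" "W \<union> A"]) auto
      then have "card (Sigma S X) = (\<Sum>y\<in>S. card (X y))" using fin(1) by (intro card_SigmaI) auto
      then show ?thesis using X by simp
    qed
    finally show "measure_pmf.prob (G E2) {h. \<not> completes \<alpha> A S F W (\<lambda>e. if e \<in> E1 then g e else h e)}
        \<le> (1 - p / l) ^ (card S * m r)" .
  qed
  also have "measure_pmf.prob (G E1) {g. bad g} \<le> real (card S) * (real r * \<eta>)"
  proof -
    have "{g. bad g} = (\<Union>y\<in>S. {g. card (reach g (A' y) (F2 y) W r) < m r})"
      by (auto simp: bad_def)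
    then have "measure_pmf.prob (G E1) {g. bad g}
        \<le> (\<Sum>y\<in>S. measure_pmf.prob (G E1) {g. card (reach g (A' y) (F2 y) W r) < m r})"
      using measure_pmf.finite_measure_subadditive_finite[OF fin(1)] by simp
    also have "\<dots> \<le> (\<Sum>y\<in>S. real r * \<eta>)"
    proof (rule sum_mono, rule reach_prob[OF gr assms(2) st finE(1)])
      fix y assume "y \<in> S"
      then show "pairs (A' y \<union> W) \<subseteq> E1"
        using A' pairs_mono[of "A' y \<union> W" "W \<union> A"] sub1 by blast
    qed
    finally show ?thesis by simp
  qed
  finally show ?thesis by simp
qed

text \<open>The neighbours \<open>B\<close> of \<open>v\<close> form level 0, each with one used
  colour. \<open>growth\<close> takes them to depth \<open>r1\<close> without touching
  \<open>A\<close>, and \<open>completes_base\<close> finishes. At that point \<open>w1\<close>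
  vertices are still unexplored, enough for the trees from \<open>u\<close>.\<close>

lemma completes_prob:
  assumes gr1: "grows m1 1 w1 r1 \<eta>" and gr: "grows m (Suc (Suc r1)) w0 r \<eta>" and "0 \<le> \<eta>"
    and l: "Suc (Suc (Suc r1) + r) \<le> l"
    and fin: "finite A" "finite B" "finite W"
    and disj: "A \<inter> B = {}" "(A \<union> B) \<inter> W = {}"
    and inj: "inj_on \<alpha> A" and m: "m 0 + Suc (Suc r1) \<le> card A" "card B = m1 0"
    and w1: "w0 + (\<Sum>j\<in>{0<..r}. real (m j)) \<le> w1"
    and W: "w1 + (\<Sum>j\<in>{0<..r1}. real (m1 j)) \<le> real (card W)"
  shows "measure_pmf.prob (G (pairs (A \<union> B \<union> W))) {f. \<not> completes \<alpha> A B (\<lambda>y. {0, \<beta> y}) W f}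
     \<le> real r1 * \<eta> + (real (m1 r1) * (real r * \<eta>) + (1 - p / l) ^ (m1 r1 * m r))"
proof -
  have nn: "0 \<le> (1 - p / l) ^ (m1 r1 * m r)"
  proof -
    have "p / l \<le> 1" using p_le_1 l_pos by (simp add: divide_le_eq)
    then show ?thesis by simp
  qed
  have "measure_pmf.prob (G (pairs (A \<union> B \<union> W))) {f. \<not> completes \<alpha> A B (\<lambda>y. {0, \<beta> y}) W f}
     \<le> real (r1 - 0) * \<eta> + (real (m1 r1) * (real r * \<eta>) + (1 - p / l) ^ (m1 r1 * m r))"
  proof (rule growth[OF gr1 _ assms(3), where A = A and Succ = "\<lambda>_. completes \<alpha> A"])
    show "0 \<le> real (m1 r1) * (real r * \<eta>) + (1 - p / l) ^ (m1 r1 * m r)" using assms(3) nn by simp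
    show "exploration m1 1 w1 r1 A 0 B (\<lambda>y. {0, \<beta> y}) W"
      unfolding exploration_def using fin disj m W by (auto simp: card_insert_if)
    show "finite (pairs (A \<union> B \<union> W))" using fin by simp
    show "pairs (B \<union> W \<union> A) \<subseteq> pairs (A \<union> B \<union> W)" by (rule pairs_mono) auto
  next
    fix i :: nat and T F W T' F' f
    assume *: "exploration m1 1 w1 r1 A i T F W" "T' \<subseteq> W"
      "\<And>w. w \<in> T' \<Longrightarrow> \<exists>x\<in>T. f {x, w} \<notin> F x \<and> F' w = insert (f {x, w}) (F x)"
      "completes \<alpha> A T' F' (W - T') f"
    from *(4) obtain w zs where w: "w \<in> T'" "zs \<noteq> []" "last zs \<in> A" "\<alpha> (last zs) \<notin> F' w"
      "rpath f (insert (\<alpha> (last zs)) (F' w)) (insert w (W - T' \<union> A)) (w # zs)"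
      unfolding completes_def by blast
    obtain x where x: "x \<in> T" "f {x, w} \<notin> F x" "F' w = insert (f {x, w}) (F x)"
      using *(3)[OF w(1)] by blast
    have "set (w # zs) \<subseteq> W \<union> A" using w(1,5) *(2) by (auto simp: rpath_def)
    then have "x \<notin> set (w # zs)" using x(1) *(1) by (auto simp: exploration_def)
    moreover have "rpath f (insert (f {x, w}) (insert (\<alpha> (last zs)) (F x))) (insert x (W \<union> A)) (w # zs)"
      using *(2) w(1) x(3) by (intro rpath_mono[OF w(5)]) auto
    moreover have "f {x, w} \<noteq> \<alpha> (last zs)" using w(4) x(3) by auto
    ultimately have "rpath f (insert (\<alpha> (last zs)) (F x)) (insert x (W \<union> A)) (x # w # zs)"
      unfolding rpath_Cons_Cons using x by auto
    then show "completes \<alpha> A T F W f"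
      unfolding completes_def using x w by (intro bexI[of _ x] exI[of _ "w # zs"]) auto
  next
    fix i :: nat and T F W and f g :: "'a set \<Rightarrow> nat"
    assume *: "\<And>e. e \<in> pairs (T \<union> W \<union> A) \<Longrightarrow> f e = g e" "completes \<alpha> A T F W f"
    have "rpath f X (insert y (W \<union> A)) zs \<longleftrightarrow> rpath g X (insert y (W \<union> A)) zs" if "y \<in> T" for y zs X
      by (rule rpath_cong, rule *(1)) (use that pairs_mono[of "insert y (W \<union> A)" "T \<union> W \<union> A"] in auto)
    then show "completes \<alpha> A T F W g" using *(2) unfolding completes_def by blast
  next
    fix T W :: "'a set" and F and E :: "'a set set"
    assume st: "exploration m1 1 w1 r1 A r1 T F W" and E: "finite E" "pairs (T \<union> W \<union> A) \<subseteq> E"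
    show "measure_pmf.prob (G E) {f. \<not> completes \<alpha> A T F W f}
      \<le> real (m1 r1) * (real r * \<eta>) + (1 - p / l) ^ (m1 r1 * m r)"
      using completes_base[OF gr assms(3) l, of T W A F \<alpha> E] st E fin inj m w1
      unfolding exploration_def by auto
  qed simp
  then show ?thesis by simp
qed

end

text \<open>The colours are required to be distinct so that forbidding \<open>k\<close> colours costs at most \<open>k\<close> of the
  neighbours.\<close>

definition colourful :: "'a set \<Rightarrow> nat \<Rightarrow> ('a set \<Rightarrow> nat) \<Rightarrow> 'a \<Rightarrow> bool" where
  "colourful V d f u \<longleftrightarrow>
     (\<exists>N. N \<subseteq> V - {u} \<and> card N = d \<and> inj_on (\<lambda>x. f {u, x}) N \<and> (\<forall>x\<in>N. f {u, x} \<noteq> 0))"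

lemma colourful_cong:
  assumes "\<And>x. x \<in> V \<Longrightarrow> x \<noteq> u \<Longrightarrow> f {u, x} = g {u, x}"
  shows "colourful V d f u \<longleftrightarrow> colourful V d g u"
proof -
  have "f {u, x} = g {u, x}" if "N \<subseteq> V - {u}" "x \<in> N" for N x
    using that assms by auto
  then show ?thesis unfolding colourful_def
    by (intro ex_cong1 conj_cong refl inj_on_cong ball_cong) metis+
qed

section \<open>Neighbourhoods with many colours and joining a fixed pair\<close>

definition joined :: "'a set \<Rightarrow> ('a set \<Rightarrow> nat) \<Rightarrow> 'a \<Rightarrow> 'a \<Rightarrow> bool" where
  "joined V f u v \<longleftrightarrow> (\<exists>zs. zs \<noteq> [] \<and> hd zs = u \<and> last zs = v \<and> rpath f {0} V zs)"

context edge_model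
begin

text \<open>Colours are grouped into residue classes modulo \<open>l\<close> because the union bound over sets of colour
  groups must cost only \<open>2 ^ l\<close>, whereas the number of colours is arbitrary.\<close>

lemma not_colourful_prob:
  assumes "finite V" "u \<in> V"
    and b: "\<And>J. J \<subseteq> {..<l} \<Longrightarrow> card J \<le> d \<Longrightarrow> b \<le> measure_pmf.prob q (- {x. x = 0 \<or> x mod l \<in> J})"
    and "b \<le> 1"
  shows "measure_pmf.prob (G (pairs V)) {f. \<not> colourful V d f u} \<le> 2 ^ l * (1 - b) ^ (card V - 1)"
proof -
  define H where "H J = {x. x = 0 \<or> x mod l \<in> J}" for J
  let ?Js = "{J. J \<subseteq> {..<l} \<and> card J \<le> d}"
  have fin: "finite ?Js" by (rule finite_subset[of _ "Pow {..<l}"]) auto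
  have "{f. \<not> colourful V d f u} \<subseteq> (\<Union>J\<in>?Js. {f. \<forall>x\<in>V - {u}. f {u, x} \<in> H J})"
  proof
    fix f assume "f \<in> {f. \<not> colourful V d f u}"
    then have nn: "\<not> colourful V d f u" by simp
    \<comment> \<open>\<open>J\<close> collects the residues of the colours seen at
      \<open>u\<close>. More than \<open>d\<close> residues would give \<open>d\<close> neighbours
      with distinct colours; so \<open>J\<close> is small, and every edge at \<open>u\<close> is
      absent or has its residue in \<open>J\<close>.\<close>
    define X where "X = {x \<in> V - {u}. f {u, x} \<noteq> 0}"
    define J where "J = (\<lambda>x. f {u, x} mod l) ` X"
    have "card J \<le> d"
    proof (rule ccontr)
      assume "\<not> card J \<le> d"
      then obtain J' where J': "J' \<subseteq> J" "card J' = d" using ex_subset_card[of d J] by auto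
      then obtain N where N: "N \<subseteq> X" "inj_on (\<lambda>x. f {u, x} mod l) N" "J' = (\<lambda>x. f {u, x} mod l) ` N"
        unfolding J_def subset_image_inj by blast
      then have "card N = d" using J'(2) by (simp add: card_image)
      moreover have "inj_on (\<lambda>x. f {u, x}) N" using N(2) by (auto simp: inj_on_def)
      ultimately have "colourful V d f u" unfolding colourful_def using N(1) by (intro exI[of _ N]) (auto simp: X_def)
      with nn show False by simp
    qed
    moreover have "J \<subseteq> {..<l}" using l_pos by (auto simp: J_def)
    moreover have "f {u, x} \<in> H J" if "x \<in> V - {u}" for x
      using that by (auto simp: H_def J_def X_def)
    ultimately show "f \<in> (\<Union>J\<in>?Js. {f. \<forall>x\<in>V - {u}. f {u, x} \<in> H J})" by auto
  qed
  then have "measure_pmf.prob (G (pairs V)) {f. \<not> colourful V d f u}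
      \<le> measure_pmf.prob (G (pairs V)) (\<Union>J\<in>?Js. {f. \<forall>x\<in>V - {u}. f {u, x} \<in> H J})"
    by (intro measure_pmf.finite_measure_mono) auto
  also have "\<dots> \<le> (\<Sum>J\<in>?Js. measure_pmf.prob (G (pairs V)) {f. \<forall>x\<in>V - {u}. f {u, x} \<in> H J})"
    by (rule measure_pmf.finite_measure_subadditive_finite[OF fin]) auto
  also have "\<dots> \<le> (\<Sum>J\<in>?Js. (1 - b) ^ card (V - {u}))"
  proof (rule sum_mono, rule prob_all_within[where k = "\<lambda>x. {u, x}"])
    show "inj_on (\<lambda>x. {u, x}) (V - {u})" by (auto simp: inj_on_def doubleton_eq_iff)
    show "(\<lambda>x. {u, x}) ` (V - {u}) \<subseteq> pairs V" using assms(2) by (auto intro!: pair_in_pairs)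
  qed (use assms b in \<open>auto simp: H_def\<close>)
  also have "\<dots> = card ?Js * (1 - b) ^ (card V - 1)" using assms(1,2) by simp
  also have "\<dots> \<le> 2 ^ l * (1 - b) ^ (card V - 1)"
  proof (rule mult_right_mono)
    have "card ?Js \<le> card (Pow {..<l})" by (rule card_mono) auto
    then have "card ?Js \<le> 2 ^ l" by (simp add: card_Pow)
    then show "real (card ?Js) \<le> 2 ^ l" by (metis of_nat_le_iff of_nat_numeral of_nat_power)
  qed (use assms in auto)
  finally show ?thesis .
qed

text \<open>The edges at \<open>u\<close> and \<open>v\<close> are exposed first. If both vertices
  are colourful, disjoint sets \<open>A\<close> and \<open>B\<close> of \<open>h\<close> neighbours
  are fixed, and \<open>completes_prob\<close> applies to the edges inside
  \<open>V - {u, v}\<close>, which are independent of the exposed ones.\<close>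

lemma not_joined_prob:
  fixes V :: "'a set"
  assumes gr1: "grows m1 1 w1 r1 \<eta>" and gr: "grows m (Suc (Suc r1)) w0 r \<eta>" and "0 \<le> \<eta>"
    and l: "Suc (Suc (Suc r1) + r) \<le> l"
    and V: "finite V" "u \<in> V" "v \<in> V" "u \<noteq> v"
    and h: "2 * h + 1 \<le> d" "m 0 + Suc (Suc r1) \<le> h" "m1 0 = h"
    and w1: "w0 + (\<Sum>j\<in>{0<..r}. real (m j)) \<le> w1"
    and W: "w1 + (\<Sum>j\<in>{0<..r1}. real (m1 j)) + real (2 * h + 2) \<le> real (card V)"
  shows "measure_pmf.prob (G (pairs V)) {f. colourful V d f u \<and> colourful V d f v \<and> \<not> joined V f v u}
     \<le> real r1 * \<eta> + (real (m1 r1) * (real r * \<eta>) + (1 - p / l) ^ (m1 r1 * m r))" (is "_ \<le> ?bd")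
proof -
  define V0 where "V0 = V - {u, v}"
  define E1 where "E1 = {e \<in> pairs V. u \<in> e \<or> v \<in> e}"
  define E2 where "E2 = pairs V0"
  have EE: "pairs V = E1 \<union> E2" by (auto simp: E1_def E2_def pairs_def V0_def)
  have fin: "finite E1" "finite E2" "E1 \<inter> E2 = {}"
    using V(1) by (auto simp: E1_def E2_def V0_def) (auto simp: pairs_def)
  have nn: "0 \<le> (1 - p / l) ^ (m1 r1 * m r)"
  proof -
    have "p / l \<le> 1" using p_le_1 l_pos by (simp add: divide_le_eq)
    then show ?thesis by simp
  qed
  have bd0: "0 \<le> ?bd" using nn assms(3) by simp
  have E1u: "{u, x} \<in> E1" if "x \<in> V" "x \<noteq> u" for x
    using that V by (auto simp: E1_def intro!: pair_in_pairs)
  have E1v: "{v, x} \<in> E1" if "x \<in> V" "x \<noteq> v" for x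
    using that V by (auto simp: E1_def intro!: pair_in_pairs)
  \<comment> \<open>No outcome has to be set aside as bad: if the exposed edges make
    \<open>u\<close> or \<open>v\<close> not colourful, the event is impossible.\<close>
  have "measure_pmf.prob (G (pairs V)) {f. colourful V d f u \<and> colourful V d f v \<and> \<not> joined V f v u}
     \<le> measure_pmf.prob (G E1) {g. False} + ?bd"
    unfolding EE
  proof (rule prob_Pi_pmf_split[OF fin _ bd0])
    fix g :: "'a set \<Rightarrow> nat"
    let ?f = "\<lambda>h e. if e \<in> E1 then g e else h e"
    have eqn: "colourful V d (?f h) u \<longleftrightarrow> colourful V d g u" "colourful V d (?f h) v \<longleftrightarrow> colourful V d g v" for h
    proof -
      show "colourful V d (?f h) u \<longleftrightarrow> colourful V d g u" by (rule colourful_cong) (simp add: E1u)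
      show "colourful V d (?f h) v \<longleftrightarrow> colourful V d g v" by (rule colourful_cong) (simp add: E1v)
    qed
    show "measure_pmf.prob (G E2) {h. colourful V d (?f h) u \<and> colourful V d (?f h) v \<and> \<not> joined V (?f h) v u} \<le> ?bd"
    proof (cases "colourful V d g u \<and> colourful V d g v")
      case False
      then have empty: "{h. colourful V d (?f h) u \<and> colourful V d (?f h) v \<and> \<not> joined V (?f h) v u} = {}"
        unfolding eqn by auto
      show ?thesis unfolding empty using bd0 by (simp only: measure_empty)
    next
      case True
      then obtain Nu Nv where
        Nu: "Nu \<subseteq> V - {u}" "card Nu = d" "inj_on (\<lambda>x. g {u, x}) Nu" "\<And>x. x \<in> Nu \<Longrightarrow> g {u, x} \<noteq> 0" and
        Nv: "Nv \<subseteq> V - {v}" "card Nv = d" "inj_on (\<lambda>x. g {v, x}) Nv" "\<And>x. x \<in> Nv \<Longrightarrow> g {v, x} \<noteq> 0"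
        unfolding colourful_def by blast
      have finN: "finite Nu" "finite Nv" using Nu(1) Nv(1) V(1) finite_subset by blast+
      \<comment> \<open>The bound \<open>2 * h + 1 \<le> d\<close> covers both choices:
        \<open>A\<close> must avoid \<open>v\<close>, and \<open>B\<close> must avoid
        \<open>u\<close> and the \<open>h\<close> elements of \<open>A\<close>.\<close>
      have "card Nu - card {v} \<le> card (Nu - {v})" by (intro diff_card_le_card_Diff) auto
      then have "h \<le> card (Nu - {v})" using h(1) Nu(2) by simp
      then obtain A where A: "A \<subseteq> Nu - {v}" "card A = h" using ex_subset_card[of h] by blast
      then have finA: "finite A" using finN finite_subset by blast
      have "card Nv - card (insert u A) \<le> card (Nv - insert u A)"
        using finA by (intro diff_card_le_card_Diff) auto
      moreover have "card (insert u A) \<le> Suc h" using A(2) finA by (simp add: card_insert_if)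
      ultimately have "h \<le> card (Nv - insert u A)" using h(1) Nv(2) by simp
      then obtain B where B: "B \<subseteq> Nv - insert u A" "card B = h" using ex_subset_card[of h] by blast
      then have finB: "finite B" using finN finite_subset by blast
      define \<alpha> where "\<alpha> x = g {u, x}" for x
      define \<beta> where "\<beta> y = g {v, y}" for y
      define W where "W = V0 - A - B"
      have AB: "A \<subseteq> V0" "B \<subseteq> V0" "A \<inter> B = {}"
        using A(1) B(1) Nu(1) Nv(1) by (auto simp: V0_def)
      have V0: "V0 = A \<union> B \<union> W" using AB by (auto simp: W_def)
      have cW: "real (card W) = real (card V) - real (2 * h + 2)"
      proof -
        have "V = {u, v} \<union> (A \<union> B \<union> W)" using V0 V by (auto simp: V0_def)
        moreover have "finite W" using V(1) by (simp add: W_def V0_def)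
        moreover have "{u, v} \<inter> (A \<union> B \<union> W) = {}" using V0 by (auto simp: V0_def)
        moreover have "(A \<union> B) \<inter> W = {}" by (auto simp: W_def)
        ultimately have "card V = 2 + (h + h + card W)"
          using finA finB AB(3) A(2) B(2) V(4) by (simp add: card_Un_disjoint)
        then show ?thesis by simp
      qed
      have "measure_pmf.prob (G E2) {h. colourful V d (?f h) u \<and> colourful V d (?f h) v \<and> \<not> joined V (?f h) v u}
          \<le> measure_pmf.prob (G (pairs (A \<union> B \<union> W))) {f. \<not> completes \<alpha> A B (\<lambda>y. {0, \<beta> y}) W f}"
        unfolding E2_def V0[symmetric]
      proof (rule measure_pmf.finite_measure_mono, intro Collect_mono impI notI)
        fix h assume no: "colourful V d (?f h) u \<and> colourful V d (?f h) v \<and> \<not> joined V (?f h) v u"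
        assume "completes \<alpha> A B (\<lambda>y. {0, \<beta> y}) W h"
        then obtain y zs where y: "y \<in> B" "zs \<noteq> []" "last zs \<in> A" "\<alpha> (last zs) \<notin> {0, \<beta> y}"
          "rpath h (insert (\<alpha> (last zs)) {0, \<beta> y}) (insert y (W \<union> A)) (y # zs)"
          unfolding completes_def by blast
        have "rpath (?f h) (insert (\<alpha> (last zs)) {0, \<beta> y}) V0 (y # zs)
            \<longleftrightarrow> rpath h (insert (\<alpha> (last zs)) {0, \<beta> y}) V0 (y # zs)"
          by (rule rpath_cong) (use fin(3) in \<open>auto simp: E2_def\<close>)
        moreover have "rpath h (insert (\<alpha> (last zs)) {0, \<beta> y}) V0 (y # zs)"
          by (rule rpath_mono[OF y(5)]) (use y(1) V0 in auto)
        ultimately have rp: "rpath (?f h) (insert (\<alpha> (last zs)) {0, \<beta> y}) V0 (y # zs)" by simp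
        have sub: "set (y # zs) \<subseteq> V0" using rp by (simp add: rpath_def)
        have la: "?f h {last (y # zs), u} = \<alpha> (last zs)"
          using y(2,3) AB(1) E1u[of "last zs"] by (auto simp: V0_def \<alpha>_def insert_commute)
        have vb: "?f h {v, y} = \<beta> y"
          using y(1) AB(2) E1v[of y] by (auto simp: V0_def \<beta>_def)
        \<comment> \<open>The path is closed at both ends by exposed edges, whose colours \<alpha>
          and \<beta> were kept forbidden in between.\<close>
        have rp': "rpath (?f h) {0, \<beta> y} (insert u V0) ((y # zs) @ [u])"
        proof (rule rpath_snoc)
          show "rpath (?f h) (insert (?f h {last (y # zs), u}) {0, \<beta> y}) (insert u V0) (y # zs)"
            unfolding la by (rule rpath_mono[OF rp]) auto
          show "?f h {last (y # zs), u} \<notin> {0, \<beta> y}" unfolding la by (rule y(4))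
          show "u \<notin> set (y # zs)" using sub by (auto simp: V0_def)
        qed auto
        have "rpath (?f h) (insert (?f h {v, y}) {0}) V (y # zs @ [u])"
          unfolding vb using rpath_mono[OF rp', of "{\<beta> y, 0}" V] V by (auto simp: V0_def)
        moreover have "v \<notin> set (y # zs @ [u])" using sub V(4) by (auto simp: V0_def)
        moreover have "?f h {v, y} \<notin> {0}" unfolding vb using Nv(4)[of y] y(1) B(1) by (auto simp: \<beta>_def)
        ultimately have "rpath (?f h) {0} V (v # y # zs @ [u])"
          unfolding rpath_Cons_Cons using V(3) by blast
        then have "joined V (?f h) v u" unfolding joined_def
          by (intro exI[of _ "v # y # zs @ [u]"]) auto
        with no show False by simp
      qed simp
      also have "\<dots> \<le> ?bd"
      proof (rule completes_prob[OF gr1 gr assms(3) l finA finB])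
        show "finite W" using V(1) by (simp add: W_def V0_def)
        show "(A \<union> B) \<inter> W = {}" by (auto simp: W_def)
        show "inj_on \<alpha> A" unfolding \<alpha>_def using Nu(3) A(1) by (meson Diff_subset inj_on_subset subset_trans)
        show "w1 + (\<Sum>j\<in>{0<..r1}. real (m1 j)) \<le> real (card W)" using W cW by linarith
      qed (use AB h A B w1 in auto)
      finally show ?thesis .
    qed
  qed
  then show ?thesis by simp
qed

end

section \<open>The coloured random graph\<close>

definition edge_colour_pmf :: "real \<Rightarrow> nat \<Rightarrow> nat pmf" where
  "edge_colour_pmf p s = bind_pmf (bernoulli_pmf p) (\<lambda>b. if b then pmf_of_set {1..s} else return_pmf 0)"

lemma prob_edge_colour_pmf:
  assumes "0 \<le> p" "p \<le> 1" "1 \<le> s" "0 \<notin> X"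
  shows "measure_pmf.prob (edge_colour_pmf p s) X = p * (card ({1..s} \<inter> X) / s)"
proof -
  have "emeasure (measure_pmf (edge_colour_pmf p s)) X
      = ennreal (p * (card ({1..s} \<inter> X) / s))"
    using assms unfolding edge_colour_pmf_def emeasure_bind_pmf
    by (subst nn_integral_bernoulli_pmf)
       (simp_all add: measure_pmf.emeasure_eq_measure measure_pmf_of_set measure_return_pmf
          ennreal_mult'[symmetric] mult.commute)
  then show ?thesis using assms by (simp add: measure_pmf.emeasure_eq_measure)
qed

text \<open>Besides \<open>0\<close>, the set \<open>F\<close> holds at most \<open>j\<close> of the
  \<open>s\<close> colours, so a fraction of at least \<open>1 - j / s\<close> remains, and
  \<open>l \<le> s\<close> makes this at least \<open>1 - j / l\<close>. Thus any larger palette is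
  treated as if it had \<open>l\<close> colours.\<close>

lemma edge_model_edge_colour_pmf:
  assumes "0 \<le> p" "p \<le> 1" "1 \<le> l" "l \<le> s"
  shows "edge_model (edge_colour_pmf p s) p l"
proof
  fix F :: "nat set" and j :: nat
  assume F: "finite F" "0 \<in> F" "card F \<le> Suc j" "j \<le> l"
  have "card ({1..s} \<inter> F) \<le> card (F - {0})" using F by (intro card_mono) auto
  then have "card ({1..s} \<inter> F) \<le> j" using F by simp
  moreover have "card ({1..s} \<inter> - F) + card ({1..s} \<inter> F) = s"
    using card_Int_Diff[of "{1..s}" F] by (simp add: Diff_eq)
  ultimately have "real s - real j \<le> real (card ({1..s} \<inter> - F))" by linarith
  then have "(real s - real j) / s \<le> real (card ({1..s} \<inter> - F)) / s" by (simp add: divide_right_mono)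
  moreover have "real j / s \<le> real j / l" using assms by (intro divide_left_mono) auto
  then have "1 - real j / l \<le> (real s - real j) / s" using assms by (simp add: diff_divide_distrib)
  ultimately have "p * (1 - real j / l) \<le> p * (real (card ({1..s} \<inter> - F)) / s)"
    using assms by (intro mult_left_mono) auto
  then show "p * (1 - real j / real l) \<le> measure_pmf.prob (edge_colour_pmf p s) (- F)"
    using assms F by (subst prob_edge_colour_pmf) auto
qed (use assms in auto)

text \<open>A residue class contains at most \<open>s div l + 1\<close> colours, which is at most
  \<open>2 * s / l\<close> because \<open>l \<le> s\<close>; the factor 2 pays for rounding.\<close>

lemma prob_residues_edge_colour_pmf:
  assumes "0 \<le> p" "p \<le> 1" "1 \<le> l" "l \<le> s" "J \<subseteq> {..<l}" "card J \<le> d"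
  shows "p * (1 - 2 * real d / l) \<le> measure_pmf.prob (edge_colour_pmf p s) (- {x. x = 0 \<or> x mod l \<in> J})"
proof -
  have finJ: "finite J" using assms(5) finite_subset by blast
  have one: "card {x \<in> {1..s}. x mod l = a} \<le> s div l + 1" for a
  proof -
    have "inj_on (\<lambda>x. x div l) {x \<in> {1..s}. x mod l = a}"
      by (intro inj_onI) (metis (mono_tags, lifting) div_mult_mod_eq mem_Collect_eq)
    then have "card {x \<in> {1..s}. x mod l = a} = card ((\<lambda>x. x div l) ` {x \<in> {1..s}. x mod l = a})"
      by (simp add: card_image)
    also have "\<dots> \<le> card {..s div l}" by (rule card_mono) (auto intro: div_le_mono)
    finally show ?thesis by simp
  qed
  let ?X = "- {x. x = 0 \<or> x mod l \<in> J}"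
  have "card ({1..s} - ?X) \<le> card (\<Union>a\<in>J. {x \<in> {1..s}. x mod l = a})"
    using finJ by (intro card_mono) auto
  also have "\<dots> \<le> (\<Sum>a\<in>J. card {x \<in> {1..s}. x mod l = a})" by (rule card_UN_le[OF finJ])
  also have "\<dots> \<le> (\<Sum>a\<in>J. s div l + 1)" by (intro sum_mono one)
  also have "\<dots> \<le> d * (s div l + 1)" using assms(6) by (simp only: sum_constant mult_right_mono of_nat_id)
  finally have "real (card ({1..s} - ?X)) \<le> real d * (real (s div l) + 1)"
    by (metis of_nat_1 of_nat_add of_nat_le_iff of_nat_mult)
  also have "\<dots> \<le> real d * (2 * real s / l)"
  proof (rule mult_left_mono)
    have "real (s div l) \<le> real s / l" by (rule of_nat_div_le_of_nat)
    moreover have "1 \<le> real s / l" using assms by simp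
    ultimately show "real (s div l) + 1 \<le> 2 * real s / l" by linarith
  qed simp
  finally have "real (card ({1..s} - ?X)) \<le> 2 * real d / l * s" by (simp add: field_simps)
  moreover have "card ({1..s} \<inter> ?X) + card ({1..s} - ?X) = s"
    using card_Int_Diff[of "{1..s}" ?X] by simp
  ultimately have "(1 - 2 * real d / l) * s \<le> real (card ({1..s} \<inter> ?X))"
    unfolding left_diff_distrib by linarith
  then have "1 - 2 * real d / l \<le> real (card ({1..s} \<inter> ?X)) / s"
    using assms by (simp add: le_divide_eq)
  then have "p * (1 - 2 * real d / l) \<le> p * (real (card ({1..s} \<inter> ?X)) / s)"
    using assms(1) by (rule mult_left_mono)
  also have "\<dots> = measure_pmf.prob (edge_colour_pmf p s) ?X"
    using assms by (intro prob_edge_colour_pmf[symmetric]) auto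
  finally show ?thesis .
qed

lemma complete_edges_eq_pairs: "complete_edges n = pairs {1..n}"
  by (simp add: complete_edges_def pairs_def)

text \<open>Drawing the graph first and the colours afterwards amounts to one independent draw per
  potential edge. This product form is the one to which \<open>edge_model\<close> applies.\<close>

lemma coloured_gnp_eq_map:
  assumes "1 \<le> s"
  shows "coloured_gnp n p s = map_pmf (\<lambda>f. ({e \<in> complete_edges n. f e \<noteq> 0}, f))
      (Pi_pmf (complete_edges n) 0 (\<lambda>_. edge_colour_pmf p s))"
proof -
  let ?K = "complete_edges n"
  let ?m = "\<lambda>f. ({e \<in> ?K. f e \<noteq> (0::nat)}, f)"
  have fin: "finite ?K" by (simp add: complete_edges_eq_pairs)
  \<comment> \<open>Colours on \<open>E\<close> are nonzero and the default off \<open>E\<close> is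
    \<open>0\<close>, so \<open>E\<close> can be read off from the colouring.\<close>
  have eq: "map_pmf ?m (Pi_pmf E 0 (\<lambda>_. pmf_of_set {1..s})) = map_pmf (Pair E) (Pi_pmf E 0 (\<lambda>_. pmf_of_set {1..s}))"
    if "E \<subseteq> ?K" for E
  proof (rule map_pmf_cong[OF refl])
    fix f assume "f \<in> set_pmf (Pi_pmf E 0 (\<lambda>_. pmf_of_set {1..s}))"
    moreover have "finite E" using that fin finite_subset by blast
    ultimately have "\<And>e. e \<in> E \<Longrightarrow> f e \<in> {1..s}" "\<And>e. e \<notin> E \<Longrightarrow> f e = 0"
      using assms by (auto simp: set_Pi_pmf PiE_dflt_def)
    then show "?m f = (E, f)" using that by force
  qed
  have "Pi_pmf ?K 0 (\<lambda>_. edge_colour_pmf p s)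
     = bind_pmf (Pi_pmf ?K False (\<lambda>_. bernoulli_pmf p))
         (\<lambda>\<phi>. Pi_pmf ?K 0 (\<lambda>e. if \<phi> e then pmf_of_set {1..s} else return_pmf 0))"
    unfolding edge_colour_pmf_def by (rule Pi_pmf_bind[OF fin])
  also have "\<dots> = bind_pmf (gnp n p) (\<lambda>E. random_colouring E s)"
    by (simp add: gnp_def bind_map_pmf random_colouring_def Pi_pmf_if_set[OF fin])
  finally have "map_pmf ?m (Pi_pmf ?K 0 (\<lambda>_. edge_colour_pmf p s))
     = bind_pmf (gnp n p) (\<lambda>E. map_pmf ?m (random_colouring E s))" by (simp add: map_bind_pmf)
  also have "\<dots> = bind_pmf (gnp n p) (\<lambda>E. map_pmf (Pair E) (random_colouring E s))"
  proof (rule bind_pmf_cong[OF refl])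
    fix E assume "E \<in> set_pmf (gnp n p)"
    then have "E \<subseteq> ?K" by (auto simp: gnp_def)
    then show "map_pmf ?m (random_colouring E s) = map_pmf (Pair E) (random_colouring E s)"
      unfolding random_colouring_def by (rule eq)
  qed
  also have "\<dots> = coloured_gnp n p s" by (simp add: coloured_gnp_def map_pmf_def)
  finally show ?thesis by simp
qed

lemma joined_rainbow:
  assumes "\<And>u v. u \<in> {1..n} \<Longrightarrow> v \<in> {1..n} \<Longrightarrow> u \<noteq> v \<Longrightarrow> joined {1..n} f u v"
  shows "rainbow_connected {1..n} {e \<in> complete_edges n. f e \<noteq> 0} f"
  unfolding rainbow_connected_def
proof (intro ballI impI)
  fix u v assume "u \<in> {1..n}" "v \<in> {1..n}" "u \<noteq> v"
  from assms[OF this] obtain zs where zs: "zs \<noteq> []" "hd zs = u" "last zs = v" "rpath f {0} {1..n} zs"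
    unfolding joined_def by blast
  have "set (walk_edges zs) \<subseteq> complete_edges n"
    unfolding complete_edges_eq_pairs using zs(4) by (intro walk_edges_subset_pairs) (auto simp: rpath_def)
  then have "path_between {1..n} {e \<in> complete_edges n. f e \<noteq> 0} u v zs"
    using zs unfolding path_between_def rpath_def by auto
  moreover have "rainbow f zs" using zs(4) by (simp add: rainbow_def rpath_def)
  ultimately show "\<exists>xs. path_between {1..n} {e \<in> complete_edges n. f e \<noteq> 0} u v xs \<and> rainbow f xs" by blast
qed

section \<open>Level sizes\<close>

text \<open>The left side is one term of the exponential series; \<open>x = k = l\<close> gives
  \<open>l! \<ge> (l / e) ^ l\<close>.\<close>

lemma power_div_fact_le_exp:
  fixes x :: real
  assumes "0 \<le> x"
  shows "x ^ k / fact k \<le> exp x"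
proof -
  have "(\<Sum>i<Suc k. x ^ i /\<^sub>R fact i) \<le> exp x"
    using assms sum_le_suminf[OF sums_summable[OF exp_converges[of x]], of "{..<Suc k}"]
      sums_unique[OF exp_converges[of x]]
    by (simp add: sum_nonneg)
  moreover have "x ^ k / fact k \<le> (\<Sum>i<Suc k. x ^ i /\<^sub>R fact i)"
    using assms by (simp add: sum_nonneg divide_inverse_commute)
  ultimately show ?thesis by linarith
qed

text \<open>The product equals \<open>(l - 6)! / l ^ (l - 7)\<close>, and
  \<open>(l - 6)! \<ge> l! / l ^ 6 \<ge> (l / e) ^ l / l ^ 6\<close>.\<close>

lemma falling_prod_ge:
  assumes "7 \<le> l"
  shows "real l * exp (- real l) \<le> (\<Prod>i<l - 7. 1 - real (6 + i) / l)"
proof -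
  define r where "r = l - 7"
  have l: "l = r + 7" using assms by (simp add: r_def)
  have "(\<Prod>i<r. 1 - real (6 + i) / l) = (\<Prod>i<r. real (r + 1 - i) / l)"
    by (rule prod.cong) (auto simp: l field_simps of_nat_diff)
  also have "\<dots> = (\<Prod>i<r. real (r + 1 - i)) / real l ^ r"
    by (simp add: prod_dividef)
  also have "(\<Prod>i<r. real (r + 1 - i)) = fact (r + 1)"
    using fact_prod_rev[of "r + 1", where 'a = real] by (simp add: atLeast0LessThan)
  finally have eq: "(\<Prod>i<r. 1 - real (6 + i) / l) = fact (r + 1) / real l ^ r" .
  have "fact l \<le> l ^ 6 * fact (r + 1)"
  proof -
    have "fact l = (fact l div fact (l - 6)) * (fact (l - 6) :: nat)"
      by (simp add: fact_dvd)
    also have "\<dots> \<le> l ^ 6 * fact (l - 6)"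
      using fact_div_fact_le_pow[of 6 l] assms by (intro mult_right_mono) auto
    finally show ?thesis by (simp add: l)
  qed
  then have f: "fact l \<le> real l ^ 6 * (fact (r + 1) :: real)"
    using of_nat_mono[of "fact l" "l ^ 6 * fact (r + 1)", where 'a = real] by (simp add: algebra_simps)
  have "real l ^ l \<le> exp (real l) * fact l"
    using power_div_fact_le_exp[of "real l" l] by (simp add: divide_le_eq)
  also have "\<dots> \<le> exp (real l) * (real l ^ 6 * fact (r + 1))" using f by (intro mult_left_mono) auto
  finally have "real l ^ r * real l ^ 7 \<le> exp (real l) * fact (r + 1) * real l ^ 6"
    by (simp add: l power_add[symmetric] mult_ac)
  then have "real l ^ 6 * (real l ^ r * real l) \<le> real l ^ 6 * (exp (real l) * fact (r + 1))"
    by (simp add: power_numeral_reduce mult_ac)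
  then have "real l ^ r * real l \<le> exp (real l) * fact (r + 1)"
    using assms by (subst (asm) mult_le_cancel_left_pos) auto
  then have "real l * exp (- real l) \<le> fact (r + 1) / real l ^ r"
    using assms by (simp add: exp_minus field_simps)
  then show ?thesis using eq by (simp add: r_def)
qed

context edge_model
begin

text \<open>This is the tree from \<open>v\<close>, with \<tau> equal to \<open>1 / 2\<close>
  throughout. The factor \<open>x / 16\<close> combines \<open>w1 \<ge> n / 2\<close>, a colour
  fraction of at least \<open>1 / 2\<close>, and \<open>(1 - \<tau>)^2 = 1 / 4\<close>. At least 384
  vertices make the exponent \<open>384 * L / 64 = 6 * L\<close>.\<close>

lemma grows_start:
  fixes n x L w1 :: real and h :: nat
  assumes x: "x = p * n" and w1: "n / 2 \<le> w1" and L: "16 \<le> L" "L \<le> x" and l: "8 \<le> l"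
    and h: "384 \<le> h" "real h \<le> L" and small: "p * (L * x ^ 4 + 1) \<le> 1 / 2"
  shows "grows (\<lambda>i. nat \<lceil>real h * (x / 16) ^ i\<rceil>) 1 w1 4 (exp (- 6 * L))"
  unfolding grows_def
proof (intro allI impI conjI)
  fix i :: nat assume i: "i < 4"
  show "1 + i \<le> l" using i l by simp
  define b where "b = real h * (x / 16) ^ i"
  define m where "m = real (nat \<lceil>b\<rceil>)"
  define f where "f = 1 - real (1 + i) / l"
  define Q where "Q = p * f * m * (1 - 1 / 2) * w1"
  have x0: "1 \<le> x" using L by simp
  have b0: "0 \<le> b" using x0 by (simp add: b_def)
  have bm: "b \<le> m" "m \<le> b + 1" unfolding m_def using b0 by linarith+
  have "(x / 16) ^ i \<le> x ^ i" using x0 by (intro power_mono) auto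
  also have "\<dots> \<le> x ^ 4" using x0 i by (intro power_increasing) auto
  finally have "b \<le> L * x ^ 4" unfolding b_def using h(2) x0 L by (intro mult_mono) auto
  then have "p * m \<le> p * (L * x ^ 4 + 1)" using bm p_nonneg by (intro mult_left_mono) auto
  with small have pm: "p * m \<le> 1 / 2" by linarith
  have mh: "384 \<le> m"
  proof -
    have "1 \<le> (x / 16) ^ i" using L by (intro one_le_power) auto
    then have "real h * 1 \<le> b" unfolding b_def by (intro mult_left_mono) auto
    then show ?thesis using bm h(1) by simp
  qed
  have f: "1 / 2 \<le> f" unfolding f_def using i l by (simp add: field_simps)
  have "x / 2 \<le> p * w1" using mult_left_mono[OF w1 p_nonneg] x by simp
  then have "1 / 2 * (x / 2) \<le> f * (p * w1)" using f x0 by (intro mult_mono) auto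
  then have "1 / 2 * (x / 2) * (m / 2) \<le> f * (p * w1) * (m / 2)" using mh by (intro mult_right_mono) auto
  then have Q: "x / 8 * m \<le> Q" by (simp add: Q_def mult_ac)
  show "\<exists>\<tau>\<ge>0. \<tau> \<le> 1 \<and> p * real (nat \<lceil>real h * (x / 16) ^ i\<rceil>) \<le> \<tau> \<and>
      real (nat \<lceil>real h * (x / 16) ^ Suc i\<rceil>) < (1 - \<tau>) * (p * (1 - real (1 + i) / real l) *
          real (nat \<lceil>real h * (x / 16) ^ i\<rceil>) * (1 - \<tau>) * w1) + 1 \<and>
      exp (- (\<tau>\<^sup>2 * (p * (1 - real (1 + i) / real l) * real (nat \<lceil>real h * (x / 16) ^ i\<rceil>) * (1 - \<tau>) * w1) / 2))
        \<le> exp (- 6 * L)"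
    unfolding b_def[symmetric] m_def[symmetric] f_def[symmetric]
  proof (intro exI[of _ "1 / 2"] conjI)
    have "real h * (x / 16) ^ Suc i = x / 16 * b" by (simp add: b_def)
    moreover have "0 \<le> x / 16 * b" using b0 x0 by simp
    ultimately have "real (nat \<lceil>real h * (x / 16) ^ Suc i\<rceil>) < x / 16 * b + 1" by linarith
    also have "\<dots> \<le> x / 16 * m + 1" using bm x0 by (intro add_right_mono mult_left_mono) auto
    also have "\<dots> \<le> (1 - 1 / 2) * Q + 1" using Q by (simp add: mult.commute)
    finally show "real (nat \<lceil>real h * (x / 16) ^ Suc i\<rceil>) < (1 - 1 / 2) * (p * f * m * (1 - 1 / 2) * w1) + 1"
      by (simp only: Q_def)
    have "L / 8 * 384 \<le> x / 8 * m" using L mh by (intro mult_mono) auto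
    then show "exp (- ((1 / 2)\<^sup>2 * (p * f * m * (1 - 1 / 2) * w1) / 2)) \<le> exp (- 6 * L)"
      using Q unfolding Q_def[symmetric] by (simp add: power2_eq_square)
  qed (use pm in auto)
qed

text \<open>The third power collects three losses: multiple hits, the Chernoff deviation, and having
  \<open>n - n / L\<close> vertices instead of \<open>n\<close>. The 6 colours in use at the start
  are the five of the leaf and that of the edge at \<open>u\<close>.\<close>

definition growth_factor :: "real \<Rightarrow> real \<Rightarrow> nat \<Rightarrow> real" where
  "growth_factor x L i = x * (1 - real (6 + i) / l) * (if i < 3 then 1 / 2 else 1 - 1 / L) ^ 3"

text \<open>The cap keeps \<open>p\<close> times the level size below \<open>1 / L\<close>, so that
  multiple hits stay negligible.\<close>

definition level_size :: "real \<Rightarrow> real \<Rightarrow> real \<Rightarrow> real \<Rightarrow> nat \<Rightarrow> real" where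
  "level_size cap a x L i = min cap (a * (\<Prod>j<i. growth_factor x L j))"

lemma fraction_ge:
  assumes "i < l - 7"
  shows "2 / real l \<le> 1 - real (6 + i) / l"
  using assms by (simp add: field_simps)

text \<open>Levels never shrink: even at the last one the colour fraction is at least
  \<open>2 / l\<close>, and \<open>x \<ge> 4 * l\<close> outweighs this together with the
  losses.\<close>

lemma growth_factor_ge_1:
  assumes "i < l - 7" "24 \<le> l" "4 * real l \<le> L" "L \<le> x"
  shows "1 \<le> growth_factor x L i"
proof (cases "i < 3")
  case True
  have "1 / 2 \<le> 1 - real (6 + i) / l" using True assms(2) by (simp add: field_simps)
  then have "16 * (1 / 2) \<le> x * (1 - real (6 + i) / l)" using assms by (intro mult_mono) auto
  then show ?thesis using True by (simp add: growth_factor_def power3_eq_cube)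
next
  case False
  have "4 * real l * (2 / l) \<le> x * (1 - real (6 + i) / l)"
    using assms fraction_ge[OF assms(1)] by (intro mult_mono) auto
  then have "8 \<le> x * (1 - real (6 + i) / l)" using assms(2) by simp
  moreover have "(1 / 2) ^ 3 \<le> (1 - 1 / L) ^ 3"
    using assms by (intro power_mono) (auto simp: field_simps)
  ultimately have "8 * (1 / 2) ^ 3 \<le> x * (1 - real (6 + i) / l) * (1 - 1 / L) ^ 3"
    by (intro mult_mono) auto
  then show ?thesis using False by (simp add: growth_factor_def power3_eq_cube)
qed

lemma prod_growth_factor_first:
  assumes "24 \<le> l" "0 \<le> x"
  shows "(x / 16) ^ 3 \<le> (\<Prod>j<3. growth_factor x L j)"
proof -
  have "x / 16 \<le> growth_factor x L j" if "j < 3" for j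
  proof -
    have "1 / 2 \<le> 1 - real (6 + j) / l" using that assms(1) by (simp add: field_simps)
    then have "x * (1 / 2) \<le> x * (1 - real (6 + j) / l)" using assms by (intro mult_left_mono) auto
    then show ?thesis using that by (simp add: growth_factor_def power3_eq_cube)
  qed
  then have "(\<Prod>j<(3::nat). x / 16) \<le> (\<Prod>j<3. growth_factor x L j)"
    using assms(2) by (intro prod_mono) auto
  then show ?thesis by simp
qed

text \<open>Three coarse levels with \<tau> equal to \<open>1 / 2\<close> bring the size to order
  \<open>L ^ 3\<close>. From there a Chernoff bound with \<tau> equal to \<open>1 / L\<close> has
  exponent at least \<open>6 * L\<close>, even when the colour fraction has dropped to
  \<open>1 / L\<close>.\<close>

lemma grows_main:
  fixes n x L a cap w0 :: real
  assumes x: "x = p * n" and w0: "w0 = n - n / L"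
    and l: "24 \<le> l" "4 * real l \<le> L" and L: "L \<le> x"
    and a: "200000 \<le> a" and cap: "48 * L ^ 3 \<le> cap" "p * (cap + 1) \<le> 1 / L"
  shows "grows (\<lambda>i. nat \<lceil>level_size cap a x L i\<rceil>) 6 w0 (l - 7) (exp (- 6 * L))"
  unfolding grows_def
proof (intro allI impI conjI)
  fix i :: nat assume i: "i < l - 7"
  then show "6 + i \<le> l" by simp
  let ?g = "growth_factor x L"
  let ?s = "level_size cap a x L"
  define P where "P k = a * (\<Prod>j<k. ?g j)" for k
  define m where "m = real (nat \<lceil>?s i\<rceil>)"
  define f where "f = 1 - real (6 + i) / l"
  define \<tau> where "\<tau> = (if i < 3 then 1 / 2 else 1 / L)"
  define Q where "Q = p * f * m * (1 - \<tau>) * w0"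
  have L96: "96 \<le> L" using l by simp
  have g1: "1 \<le> ?g j" if "j \<le> i" for j
    by (rule growth_factor_ge_1) (use that i l L in auto)
  have Pge: "a \<le> P k" if "k \<le> Suc i" for k
  proof -
    have "1 \<le> (\<Prod>j<k. ?g j)" using that g1 by (intro prod_ge_1) auto
    then have "a * 1 \<le> P k" unfolding P_def using a by (intro mult_left_mono) auto
    then show ?thesis by simp
  qed
  have s0: "200000 \<le> ?s k" if "k \<le> Suc i" for k
  proof -
    have "96 ^ 3 \<le> L ^ 3" using L96 by (intro power_mono) auto
    then have "200000 \<le> cap" using cap(1) by simp
    then show ?thesis using Pge[OF that] a unfolding level_size_def P_def[symmetric] by auto
  qed
  have sm: "?s i \<le> m" "m \<le> ?s i + 1" unfolding m_def using s0[of i] by linarith+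
  \<comment> \<open>A capped level may be followed by a capped one because the factor is at least
    1.\<close>
  have step: "?s (Suc i) \<le> ?g i * ?s i"
  proof -
    have "cap \<le> ?g i * cap" using g1[of i] cap(1) L96 mult_right_mono[of 1 "?g i" cap]
      by (smt (verit) le_refl mult_1 zero_le_power)
    moreover have "?g i * min cap (P i) = min (?g i * cap) (?g i * P i)"
      using g1[of i] by (simp add: min_mult_distrib_left)
    moreover have "P (Suc i) = ?g i * P i" by (simp add: P_def)
    ultimately show ?thesis unfolding level_size_def P_def[symmetric] by auto
  qed
  have \<tau>: "0 \<le> \<tau>" "\<tau> \<le> 1 / 2" "1 / L \<le> \<tau>" using L96 by (auto simp: \<tau>_def field_simps)
  have "m \<le> cap + 1" using sm(2) unfolding level_size_def by simp
  then have "p * m \<le> p * (cap + 1)" using p_nonneg by (intro mult_left_mono) auto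
  then have pm: "p * m \<le> \<tau>" using cap(2) \<tau>(3) by linarith
  have pw: "p * w0 = x * (1 - 1 / L)" unfolding w0 x by (simp add: algebra_simps)
  have f0: "0 < f" using fraction_ge[OF i] l(1) unfolding f_def by (smt (verit) divide_pos_pos of_nat_0_less_iff not_numeral_le_zero zero_less_iff_neq_zero)
  have Q: "x * (1 - \<tau>)\<^sup>2 * f * m \<le> Q"
  proof -
    have "x * (1 - \<tau>) \<le> p * w0" unfolding pw using \<tau> L L96 by (intro mult_left_mono) auto
    then have "x * (1 - \<tau>) * (f * m * (1 - \<tau>)) \<le> p * w0 * (f * m * (1 - \<tau>))"
      using f0 sm s0[of i] \<tau> by (intro mult_right_mono) auto
    then show ?thesis by (simp add: Q_def power2_eq_square mult_ac)
  qed
  have g: "?g i = x * f * (1 - \<tau>) ^ 3" unfolding growth_factor_def f_def \<tau>_def by simp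
  have ex: "12 * L \<le> \<tau>\<^sup>2 * Q"
  proof (cases "i < 3")
    case True
    then have \<tau>2: "\<tau> = 1 / 2" by (simp add: \<tau>_def)
    have "1 / 2 \<le> f" unfolding f_def using True l by (simp add: field_simps)
    then have "L * (1 / 2) * 200000 \<le> x * f * m" using L L96 sm s0[of i] by (intro mult_mono) auto
    then have "L * 100000 \<le> x * f * m" by simp
    moreover have "x * f * m / 4 \<le> Q" using Q \<tau>2 by (simp add: power2_eq_square)
    ultimately have "12 * L \<le> Q / 4" using L96 by linarith
    then show ?thesis by (simp add: \<tau>2 power2_eq_square)
  next
    case False
    then have \<tau>2: "\<tau> = 1 / L" by (simp add: \<tau>_def)
    \<comment> \<open>Each of the first three factors is at least \<open>x / 16\<close>, later ones
      are at least 1, and \<open>200000 / 16 ^ 3 \<ge> 48\<close>.\<close>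
    have s3: "48 * L ^ 3 \<le> ?s i"
    proof -
      have split: "(\<Prod>j<i. ?g j) = (\<Prod>j<3. ?g j) * (\<Prod>j\<in>{3..<i}. ?g j)"
        using False by (subst prod.union_disjoint[symmetric]) (auto intro!: prod.cong)
      have rest: "1 \<le> (\<Prod>j\<in>{3..<i}. ?g j)" using g1 by (intro prod_ge_1) auto
      have first: "(x / 16) ^ 3 \<le> (\<Prod>j<3. ?g j)"
        using l L L96 by (intro prod_growth_factor_first) auto
      have "0 \<le> (x / 16) ^ 3" using L L96 by simp
      then have "(x / 16) ^ 3 * 1 \<le> (\<Prod>j<i. ?g j)"
        unfolding split using first rest order_trans[OF _ first] by (intro mult_mono) auto
      moreover have "(L / 16) ^ 3 \<le> (x / 16) ^ 3" using L L96 by (intro power_mono) auto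
      ultimately have "(L / 16) ^ 3 \<le> (\<Prod>j<i. ?g j)" by linarith
      then have "200000 * (L / 16) ^ 3 \<le> P i" unfolding P_def using a L96 by (intro mult_mono) auto
      moreover have "48 * L ^ 3 \<le> 200000 * (L / 16) ^ 3"
        using L96 by (simp add: power_divide)
      ultimately show ?thesis unfolding level_size_def P_def[symmetric] using cap(1) by simp
    qed
    have "1 / L \<le> 2 / l" using l L96 by (simp add: field_simps)
    then have fL: "1 / L \<le> f" using fraction_ge[OF i] unfolding f_def by linarith
    have "1 / 4 \<le> (1 - \<tau>)\<^sup>2" using power_mono[of "1 / 2" "1 - \<tau>" 2] \<tau> by (simp add: power2_eq_square)
    then have "L * (1 / 4) * (1 / L) * (48 * L ^ 3) \<le> x * (1 - \<tau>)\<^sup>2 * f * m"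
      using L L96 fL s3 sm f0 by (intro mult_mono mult_nonneg_nonneg) auto
    then have "12 * L ^ 3 \<le> Q" using Q L96 by simp
    then have "\<tau>\<^sup>2 * (12 * L ^ 3) \<le> \<tau>\<^sup>2 * Q" by (intro mult_left_mono) auto
    then show ?thesis using L96 by (simp add: \<tau>2 power2_eq_square power3_eq_cube)
  qed
  show "\<exists>\<tau>\<ge>0. \<tau> \<le> 1 \<and> p * real (nat \<lceil>?s i\<rceil>) \<le> \<tau> \<and>
      real (nat \<lceil>?s (Suc i)\<rceil>) < (1 - \<tau>) * (p * (1 - real (6 + i) / real l) *
          real (nat \<lceil>?s i\<rceil>) * (1 - \<tau>) * w0) + 1 \<and>
      exp (- (\<tau>\<^sup>2 * (p * (1 - real (6 + i) / real l) * real (nat \<lceil>?s i\<rceil>) * (1 - \<tau>) * w0) / 2))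
        \<le> exp (- 6 * L)"
    unfolding m_def[symmetric] f_def[symmetric]
  proof (intro exI[of _ \<tau>] conjI)
    have "real (nat \<lceil>?s (Suc i)\<rceil>) < ?s (Suc i) + 1" using s0[of "Suc i"] by linarith
    also have "\<dots> \<le> ?g i * m + 1" using step sm g1[of i] mult_left_mono[of "?s i" m "?g i"] by linarith
    also have "?g i * m = (1 - \<tau>) * (x * (1 - \<tau>)\<^sup>2 * f * m)"
      unfolding g by (simp add: power2_eq_square power3_eq_cube)
    also have "\<dots> + 1 \<le> (1 - \<tau>) * Q + 1" using Q \<tau> by (intro add_right_mono mult_left_mono) auto
    finally show "real (nat \<lceil>?s (Suc i)\<rceil>) < (1 - \<tau>) * (p * f * m * (1 - \<tau>) * w0) + 1"
      by (simp only: Q_def)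
    show "exp (- (\<tau>\<^sup>2 * (p * f * m * (1 - \<tau>) * w0) / 2)) \<le> exp (- 6 * L)"
      using ex unfolding Q_def[symmetric] by simp
  qed (use pm \<tau> in auto)
qed

text \<open>The first three levels lose a factor \<open>8 ^ 3 = 512\<close>. Fewer than
  \<open>L / 4\<close> levels follow, with three factors \<open>1 - 1 / L\<close> each, so by
  Bernoulli they lose at most a factor 4; together this is 2048. The colour fractions are handled by
  \<open>falling_prod_ge\<close>.\<close>

lemma prod_growth_factor_ge:
  fixes x L :: real
  assumes l: "24 \<le> l" "4 * real l \<le> L" and "0 \<le> x"
  shows "x ^ (l - 7) * (real l * exp (- real l)) / 2048 \<le> (\<Prod>i<l - 7. growth_factor x L i)"
proof -
  define r where "r = l - 7"
  let ?t = "\<lambda>i::nat. (if i < 3 then 1 / 2 else 1 - 1 / L) ^ 3"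
  have L96: "96 \<le> L" using l by simp
  have "(\<Prod>i<r. ?t i) = (\<Prod>i<3. ?t i) * (\<Prod>i\<in>{3..<r}. ?t i)"
    using l by (subst prod.union_disjoint[symmetric]) (auto simp: r_def intro!: prod.cong)
  also have "\<dots> = (1 / 512) * (1 - 1 / L) ^ (3 * (r - 3))"
    by (simp add: power_mult lessThan_nat_numeral lessThan_Suc) (simp add: power_one_over)
  also have "\<dots> \<ge> (1 / 512) * (1 / 4)"
  proof (rule mult_left_mono)
    have "real (3 * (r - 3)) \<le> 3 / 4 * L" using l by (simp add: r_def of_nat_diff)
    then have "real (3 * (r - 3)) * (1 / L) \<le> 3 / 4" using L96 by (simp add: field_simps)
    moreover have "1 + real (3 * (r - 3)) * (- (1 / L)) \<le> (1 + - (1 / L)) ^ (3 * (r - 3))"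
      using L96 by (intro Bernoulli_inequality) (simp add: field_simps)
    ultimately show "1 / 4 \<le> (1 - 1 / L) ^ (3 * (r - 3))" by simp
  qed simp
  finally have t: "1 / 2048 \<le> (\<Prod>i<r. ?t i)" by simp
  have f: "real l * exp (- real l) \<le> (\<Prod>i<r. 1 - real (6 + i) / l)"
    unfolding r_def using l by (intro falling_prod_ge) auto
  have "x ^ r * (real l * exp (- real l)) * (1 / 2048)
      \<le> x ^ r * (\<Prod>i<r. 1 - real (6 + i) / l) * (\<Prod>i<r. ?t i)"
  proof (rule mult_mono[OF _ t])
    show "x ^ r * (real l * exp (- real l)) \<le> x ^ r * (\<Prod>i<r. 1 - real (6 + i) / l)"
      using f assms(3) by (intro mult_left_mono) auto
    have "0 \<le> (\<Prod>i<r. 1 - real (6 + i) / l)" by (rule order_trans[OF _ f]) simp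
    then show "0 \<le> x ^ r * (\<Prod>i<r. 1 - real (6 + i) / l)" using assms(3) by simp
  qed simp
  also have "\<dots> = (\<Prod>i<r. growth_factor x L i)"
    by (simp only: growth_factor_def prod.distrib prod_constant card_lessThan)
  finally show ?thesis by (simp add: r_def)
qed

text \<open>If the cap is reached, comparing powers of \<open>L\<close> and \<open>x\<close>
  suffices. Otherwise the tree from \<open>u\<close> contributes \<open>x ^ (l - 7)\<close>, that
  from \<open>v\<close> contributes \<open>x ^ 4\<close>, and \<open>p = x / n\<close> one more
  power; the missing two powers are the \<open>x^2\<close> in \<open>big\<close>. The constant
  \<open>2 ^ 27\<close> is \<open>16 ^ 4 * 2048\<close>.\<close>

lemma connecting_edges_ge:
  fixes n x L a :: real and h :: nat
  assumes x: "x = p * n" "0 < n" and l: "24 \<le> l" "4 * real l \<le> L" and L: "L \<le> x"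
    and h: "200000 \<le> h" and a: "0 \<le> a"
    and big: "3 * 2 ^ 27 * L * x\<^sup>2 * n \<le> (x / exp 1) ^ l * (real h * a)"
    and M: "real h * (x / 16) ^ 4 \<le> M" and N: "level_size (n / L ^ 3) a x L (l - 7) \<le> N"
  shows "3 * L \<le> p / l * (M * N)"
proof -
  define P where "P = a * (\<Prod>j<l - 7. growth_factor x L j)"
  have L96: "96 \<le> L" using l by simp
  have l0: "0 < real l" using l by simp
  have p: "p = x / n" using x by simp
  have low: "3 * L \<le> p / l * (real h * (x / 16) ^ 4 * level_size (n / L ^ 3) a x L (l - 7))"
  proof (cases "n / L ^ 3 \<le> P")
    case True
    then have s: "level_size (n / L ^ 3) a x L (l - 7) = n / L ^ 3"
      by (simp add: level_size_def P_def min_def)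
    \<comment> \<open>\<open>196608 = 3 * 16 ^ 4\<close>.\<close>
    have "196608 * (L * L ^ 4) \<le> real h * (x * x ^ 4)"
      using h L L96 by (intro mult_mono power_mono) auto
    moreover have "196608 * (L * (l * L ^ 3)) \<le> 196608 * (L * L ^ 4)"
      using l L96 by (simp add: power_numeral_reduce)
    ultimately have "196608 * (L * (l * L ^ 3)) \<le> real h * (x * x ^ 4)" by linarith
    then have "3 * L \<le> x / n / l * (real h * (x / 16) ^ 4 * (n / L ^ 3))"
      using l0 L96 x(2) by (simp add: power_divide field_simps)
    then show ?thesis unfolding s p .
  next
    case False
    then have s: "level_size (n / L ^ 3) a x L (l - 7) = P"
      by (simp add: level_size_def P_def min_def)
    define X where "X = x ^ (l - 7)"
    have X: "x ^ l = X * x ^ 7" using l by (simp add: X_def flip: power_add)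
    have "X * (real l * exp (- real l)) / 2048 \<le> (\<Prod>j<l - 7. growth_factor x L j)"
      unfolding X_def using l L L96 by (intro prod_growth_factor_ge) auto
    then have P: "a * (X * (real l * exp (- real l)) / 2048) \<le> P"
      unfolding P_def using a by (intro mult_left_mono) auto
    have "exp 1 ^ l = exp (real l)" by (simp flip: exp_of_nat_mult)
    then have "(x / exp 1) ^ l = X * x ^ 7 * exp (- real l)"
      unfolding power_divide X exp_minus by (simp add: divide_inverse)
    with big have "3 * 2 ^ 27 * L * x\<^sup>2 * n \<le> X * x ^ 7 * exp (- real l) * (real h * a)"
      by simp
    then have "(x\<^sup>2 * n) * (3 * 2 ^ 27 * L) \<le> (x\<^sup>2 * n) * (x ^ 5 / n * X * exp (- real l) * (real h * a))"
      using x(2) by (simp add: field_simps power_numeral_reduce)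
    then have "3 * 2 ^ 27 * L \<le> x ^ 5 / n * X * exp (- real l) * (real h * a)"
      using L L96 x(2) by (subst (asm) mult_le_cancel_left_pos) auto
    then have "3 * L \<le> x / n / l * (real h * (x / 16) ^ 4 * (a * (X * (real l * exp (- real l)) / 2048)))"
      using l0 x(2) by (simp add: field_simps power_numeral_reduce)
    also have "\<dots> \<le> x / n / l * (real h * (x / 16) ^ 4 * P)"
      using P L L96 x(2) by (intro mult_left_mono) auto
    finally show ?thesis unfolding s p .
  qed
  have g0: "0 \<le> (\<Prod>j<l - 7. growth_factor x L j)"
    by (rule prod_nonneg) (use growth_factor_ge_1 l L in force)
  then have "0 \<le> level_size (n / L ^ 3) a x L (l - 7)"
    unfolding level_size_def using a x(2) L96 by (auto intro!: mult_nonneg_nonneg)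
  then have "real h * (x / 16) ^ 4 * level_size (n / L ^ 3) a x L (l - 7) \<le> M * N"
    using M N L L96 by (intro mult_mono) (auto intro: order_trans[OF _ M])
  then have "p / l * (real h * (x / 16) ^ 4 * level_size (n / L ^ 3) a x L (l - 7)) \<le> p / l * (M * N)"
    using p_nonneg l0 by (intro mult_left_mono) auto
  with low show ?thesis by linarith
qed

text \<open>The path lengths add up to \<open>l\<close>: the edge at \<open>v\<close>, 4 levels, the
  connecting edge, \<open>l - 7\<close> levels and the edge at \<open>u\<close>. The
  \<open>n / L\<close> vertices that may be used up are split evenly between the two growth phases
  by \<open>w1\<close> and \<open>w0\<close>.\<close>

lemma not_joined_prob_le:
  fixes V :: "'a set" and n x L :: real and h d :: nat
  assumes V: "finite V" "u \<in> V" "v \<in> V" "u \<noteq> v"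
    and n: "n = real (card V)" and x: "x = p * n"
    and l: "24 \<le> l" "4 * real l \<le> L" and L: "L \<le> x"
    and h: "200006 \<le> h" "real h \<le> L" "2 * h + 1 \<le> d"
    and n1: "48 * L ^ 6 \<le> n" and n2: "p * (n / L ^ 3 + 1) \<le> 1 / L"
    and n3: "4 * (L * x ^ 4 + 1) + 2 * L + 2 \<le> n / (2 * L)"
    and n4: "p * (L * x ^ 4 + 1) \<le> 1 / 2"
    and n5: "n / L\<^sup>2 + L \<le> n / (2 * L)"
    and big: "3 * 2 ^ 27 * L * x\<^sup>2 * n \<le> (x / exp 1) ^ l * (real h * (real h - 6))"
  shows "measure_pmf.prob (G (pairs V)) {f. colourful V d f u \<and> colourful V d f v \<and> \<not> joined V f v u}
     \<le> 4 * exp (- 6 * L) + n * (n * exp (- 6 * L)) + exp (- 3 * L)"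
proof -
  define m1 where "m1 i = nat \<lceil>real h * (x / 16) ^ i\<rceil>" for i :: nat
  define cap where "cap = n / L ^ 3"
  \<comment> \<open>The \<open>0\<close> and the five colours of a leaf account for at most six
    excluded neighbours of \<open>u\<close>.\<close>
  define a where "a = real h - 6"
  define m where "m i = nat \<lceil>level_size cap a x L i\<rceil>" for i :: nat
  define r where "r = l - 7"
  define w0 where "w0 = n - n / L"
  define w1 where "w1 = n - n / (2 * L)"
  have L96: "96 \<le> L" using l by simp
  have x96: "96 \<le> x" using L L96 by simp
  have n0: "0 < n"
  proof -
    have "0 < 48 * L ^ 6" using L96 by simp
    then show ?thesis using n1 by linarith
  qed
  have cap: "48 * L ^ 3 \<le> cap"
    using n1 L96 by (simp add: cap_def field_simps flip: power_add)
  have "L \<le> L ^ 3" using L96 by (simp add: power_numeral_reduce) (smt (verit) mult_le_cancel_left1 mult_le_one)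
  then have capa: "a \<le> cap" using cap h(2) L96 unfolding a_def by linarith
  have gr1: "grows m1 1 w1 4 (exp (- 6 * L))"
    unfolding m1_def
  proof (rule grows_start[OF x])
    have "n / (2 * L) \<le> n / 2" using n0 L96 by (intro divide_left_mono) auto
    then show "n / 2 \<le> w1" by (simp add: w1_def)
  qed (use L L96 l h n4 in auto)
  have gr: "grows m (Suc (Suc 4)) w0 r (exp (- 6 * L))"
    unfolding m_def r_def
    using grows_main[OF x w0_def l L _ cap, of a] h(1) n2 by (simp add: cap_def a_def)
  have m1_le: "real (m1 j) \<le> L * x ^ 4 + 1" if "j \<le> 4" for j
  proof -
    have "(x / 16) ^ j \<le> x ^ j" using x96 by (intro power_mono) auto
    also have "\<dots> \<le> x ^ 4" using x96 that by (intro power_increasing) auto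
    finally have "real h * (x / 16) ^ j \<le> L * x ^ 4" using h(2) x96 L96 by (intro mult_mono) auto
    moreover have "0 \<le> real h * (x / 16) ^ j" using x96 by simp
    ultimately show ?thesis unfolding m1_def by linarith
  qed
  have m_le: "real (m j) \<le> cap + 1" for j
  proof -
    have "level_size cap a x L j \<le> cap" by (simp add: level_size_def)
    moreover have "0 \<le> cap" using n0 L96 by (simp add: cap_def)
    ultimately show ?thesis unfolding m_def by linarith
  qed
  have "measure_pmf.prob (G (pairs V)) {f. colourful V d f u \<and> colourful V d f v \<and> \<not> joined V f v u}
     \<le> real 4 * exp (- 6 * L) + (real (m1 4) * (real r * exp (- 6 * L)) + (1 - p / l) ^ (m1 4 * m r))"
  proof (rule not_joined_prob[OF gr1 gr _ _ V h(3)])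
    show "Suc (Suc (Suc 4) + r) \<le> l" using l by (simp add: r_def)
    have "level_size cap a x L 0 = a" using capa by (simp add: level_size_def)
    then have "m 0 = h - 6" unfolding m_def a_def using h(1) by (simp add: nat_diff_distrib)
    then show "m 0 + Suc (Suc 4) \<le> h" using h(1) by simp
    show "m1 0 = h" by (simp add: m1_def)
    have "(\<Sum>j\<in>{0<..r}. real (m j)) \<le> (\<Sum>j\<in>{0<..r}. cap + 1)" by (intro sum_mono m_le)
    also have "\<dots> = real r * (cap + 1)" by simp
    also have "\<dots> \<le> L * (cap + 1)"
      using l L96 n0 by (intro mult_right_mono) (auto simp: r_def cap_def)
    also have "\<dots> = n / L\<^sup>2 + L" using L96 by (simp add: cap_def field_simps power_numeral_reduce)
    finally have "(\<Sum>j\<in>{0<..r}. real (m j)) \<le> n / (2 * L)" using n5 by linarith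
    moreover have "n / L = n / (2 * L) + n / (2 * L)" by simp
    ultimately show "w0 + (\<Sum>j\<in>{0<..r}. real (m j)) \<le> w1" unfolding w0_def w1_def by linarith
    have "(\<Sum>j\<in>{0<..4}. real (m1 j)) \<le> (\<Sum>j\<in>{0<..4::nat}. L * x ^ 4 + 1)"
      by (intro sum_mono m1_le) auto
    also have "\<dots> = 4 * (L * x ^ 4 + 1)" by simp
    finally show "w1 + (\<Sum>j\<in>{0<..4}. real (m1 j)) + real (2 * h + 2) \<le> real (card V)"
      unfolding n[symmetric] w1_def using n3 h(2) by simp
  qed simp
  also have "\<dots> \<le> 4 * exp (- 6 * L) + (n * (n * exp (- 6 * L)) + exp (- 3 * L))"
  proof -
    define y where "y = L * x ^ 4"
    have nL: "n / (2 * L) \<le> n" using n0 L96 by (simp add: field_simps)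
    have y0: "0 \<le> y" using L96 by (simp add: y_def)
    have "4 * (y + 1) + 2 * L + 2 \<le> n" using order_trans[OF n3 nL] by (simp only: y_def)
    moreover have "real (m1 4) \<le> y + 1" using m1_le[OF order_refl] by (simp only: y_def)
    moreover have "real r \<le> L" using l L96 by (simp add: r_def)
    ultimately have "real (m1 4) \<le> n \<and> real r \<le> n" using y0 L96 by auto
    then have "real (m1 4) * (real r * exp (- 6 * L)) \<le> n * (n * exp (- 6 * L))"
      using n0 by (intro mult_mono) auto
    moreover have "(1 - p / l) ^ (m1 4 * m r) \<le> exp (- 3 * L)"
    proof -
      have "p / l \<le> 1" using p_le_1 l_pos by (simp add: divide_le_eq)
      then have "(1 - p / l) ^ (m1 4 * m r) \<le> exp (- (p / l)) ^ (m1 4 * m r)"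
        using exp_ge_add_one_self[of "- (p / l)"] by (intro power_mono) auto
      also have "\<dots> = exp (- (p / l * (real (m1 4) * real (m r))))"
        by (simp add: mult_ac flip: exp_of_nat_mult)
      also have "\<dots> \<le> exp (- 3 * L)"
      proof -
        have "3 * L \<le> p / l * (real (m1 4) * real (m r))"
        proof (rule connecting_edges_ge[OF x n0 l L])
          show "3 * 2 ^ 27 * L * x\<^sup>2 * n \<le> (x / exp 1) ^ l * (real h * a)" using big by (simp add: a_def)
          show "real h * (x / 16) ^ 4 \<le> real (m1 4)" unfolding m1_def by linarith
          show "level_size (n / L ^ 3) a x L (l - 7) \<le> real (m r)"
            unfolding m_def r_def cap_def by linarith
        qed (use h in \<open>auto simp: a_def\<close>)
        then show ?thesis by simp
      qed
      finally show ?thesis .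
    qed
    ultimately show ?thesis by linarith
  qed
  finally show ?thesis by simp
qed

end

section \<open>Union bound and asymptotics\<close>

lemma (in edge_model) all_joined_prob:
  assumes "finite V"
    and X: "\<And>u. u \<in> V \<Longrightarrow> measure_pmf.prob (G (pairs V)) {f. \<not> colourful V d f u} \<le> X"
    and Y: "\<And>u v. u \<in> V \<Longrightarrow> v \<in> V \<Longrightarrow> u \<noteq> v \<Longrightarrow>
      measure_pmf.prob (G (pairs V)) {f. colourful V d f u \<and> colourful V d f v \<and> \<not> joined V f v u} \<le> Y"
    and "0 \<le> Y"
  shows "1 - (real (card V) * X + (real (card V))\<^sup>2 * Y)
    \<le> measure_pmf.prob (G (pairs V)) {f. \<forall>u\<in>V. \<forall>v\<in>V. u \<noteq> v \<longrightarrow> joined V f u v}"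
proof -
  let ?P = "measure_pmf.prob (G (pairs V))"
  define A where "A u = {f. \<not> colourful V d f u}" for u
  define B where "B = (\<lambda>(u, v). if u = v then {} else {f. colourful V d f u \<and> colourful V d f v \<and> \<not> joined V f v u})"
  let ?S = "{f. \<forall>u\<in>V. \<forall>v\<in>V. u \<noteq> v \<longrightarrow> joined V f u v}"
  have "- ?S \<subseteq> (\<Union>u\<in>V. A u) \<union> (\<Union>e\<in>V \<times> V. B e)"
    by (fastforce simp: A_def B_def)
  then have "?P (- ?S) \<le> ?P ((\<Union>u\<in>V. A u) \<union> (\<Union>e\<in>V \<times> V. B e))"
    by (intro measure_pmf.finite_measure_mono) auto
  also have "\<dots> \<le> ?P (\<Union>u\<in>V. A u) + ?P (\<Union>e\<in>V \<times> V. B e)"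
    by (intro measure_Un_le) auto
  also have "?P (\<Union>u\<in>V. A u) \<le> (\<Sum>u\<in>V. ?P (A u))"
    using assms(1) by (intro measure_pmf.finite_measure_subadditive_finite) auto
  also have "\<dots> \<le> (\<Sum>u\<in>V. X)" using X by (intro sum_mono) (simp add: A_def)
  also have "?P (\<Union>e\<in>V \<times> V. B e) \<le> (\<Sum>e\<in>V \<times> V. ?P (B e))"
    using assms(1) by (intro measure_pmf.finite_measure_subadditive_finite) auto
  also have "\<dots> \<le> (\<Sum>e\<in>V \<times> V. Y)" using Y assms(4) by (intro sum_mono) (auto simp: B_def)
  finally have "?P (- ?S) \<le> real (card V) * X + (real (card V))\<^sup>2 * Y"
    by (simp add: power2_eq_square card_cartesian_product)
  moreover have "?P (- ?S) = 1 - ?P ?S"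
    using measure_pmf.prob_compl[of ?S "G (pairs V)"] by (simp add: Compl_eq_Diff_UNIV)
  ultimately show ?thesis by linarith
qed

text \<open>With \<open>L = ln n\<close> the failure bound for one pair has order
  \<open>1 / n ^ 3\<close>, which survives summation over \<open>n ^ 2\<close> pairs. The first
  error term is the union bound over vertices that are not colourful, with \<open>2 ^ l\<close>
  weakened to \<open>exp l\<close>.\<close>

lemma rainbow_connected_prob:
  fixes L x :: real and n s l h d :: nat
  defines "p \<equiv> x / n"
  assumes L: "L = ln n" and n: "2 \<le> n"
    and p: "p \<le> 1" and s: "l \<le> s"
    and l: "24 \<le> l" "4 * real l \<le> L" and Lx: "L \<le> x"
    and h: "200006 \<le> h" "real h \<le> L" "2 * h + 1 \<le> d"
    and d: "2 * real d / l \<le> \<kappa>" "\<kappa> \<le> 1"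
    and n1: "48 * L ^ 6 \<le> n" and n2: "p * (n / L ^ 3 + 1) \<le> 1 / L"
    and n3: "4 * (L * x ^ 4 + 1) + 2 * L + 2 \<le> n / (2 * L)"
    and n4: "p * (L * x ^ 4 + 1) \<le> 1 / 2"
    and n5: "n / L\<^sup>2 + L \<le> n / (2 * L)"
    and big: "3 * 2 ^ 27 * L * x\<^sup>2 * n \<le> (x / exp 1) ^ l * (real h * (real h - 6))"
  shows "1 - (n * (exp l * exp (- (x / n * (1 - \<kappa>) * (real n - 1)))) + 4 / n ^ 4 + 1 / n\<^sup>2 + 1 / n)
    \<le> measure_pmf.prob (coloured_gnp n p s) {(E, col). rainbow_connected {1..n} E col}"
proof -
  have L96: "96 \<le> L" using l by simp
  have p0: "0 \<le> p" using Lx L96 by (simp add: p_def)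
  have l1: "1 \<le> l" using l by simp
  interpret edge_model "edge_colour_pmf p s" p l
    by (rule edge_model_edge_colour_pmf[OF p0 p l1 s])
  define V where "V = {1..n}"
  have V: "finite V" "card V = n" by (auto simp: V_def)
  have expL: "exp L = n" using n by (simp add: L)
  define X where "X = exp (real l) * exp (- (x / n * (1 - \<kappa>) * (real n - 1)))"
  define Y where "Y = 4 * exp (- 6 * L) + real n * (real n * exp (- 6 * L)) + exp (- 3 * L)"
  have "1 - (real (card V) * X + (real (card V))\<^sup>2 * Y)
    \<le> measure_pmf.prob (G (pairs V)) {f. \<forall>u\<in>V. \<forall>v\<in>V. u \<noteq> v \<longrightarrow> joined V f u v}"
  proof (rule all_joined_prob[OF V(1), where d = d])
    fix u assume u: "u \<in> V"
    define b where "b = p * (1 - 2 * real d / l)"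
    have pb: "p * (1 - \<kappa>) \<le> b" unfolding b_def using d p0 by (intro mult_left_mono) auto
    have "b \<le> p * 1" unfolding b_def using p0 by (intro mult_left_mono) auto
    then have b1: "b \<le> 1" using p by simp
    have "measure_pmf.prob (G (pairs V)) {f. \<not> colourful V d f u} \<le> 2 ^ l * (1 - b) ^ (card V - 1)"
    proof (rule not_colourful_prob[OF V(1) u _ b1])
      fix J assume "J \<subseteq> {..<l}" "card J \<le> d"
      then show "b \<le> measure_pmf.prob (edge_colour_pmf p s) (- {x. x = 0 \<or> x mod l \<in> J})"
        unfolding b_def by (rule prob_residues_edge_colour_pmf[OF p0 p l1 s])
    qed
    also have "\<dots> \<le> X"
      unfolding X_def
    proof (rule mult_mono)
      have "(2::real) ^ l \<le> exp 1 ^ l" using exp_ge_add_one_self[of 1] by (intro power_mono) auto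
      then show "2 ^ l \<le> exp (real l)" by (simp flip: exp_of_nat_mult)
      have "(1 - b) ^ (card V - 1) \<le> exp (- (p * (1 - \<kappa>))) ^ (card V - 1)"
        using b1 pb exp_ge_add_one_self[of "- (p * (1 - \<kappa>))"] by (intro power_mono) linarith+
      also have "\<dots> = exp (- (x / n * (1 - \<kappa>) * (real n - 1)))"
        using n by (simp add: V p_def of_nat_diff mult_ac flip: exp_of_nat_mult)
      finally show "(1 - b) ^ (card V - 1) \<le> exp (- (x / n * (1 - \<kappa>) * (real n - 1)))" .
    qed (use b1 in auto)
    finally show "measure_pmf.prob (G (pairs V)) {f. \<not> colourful V d f u} \<le> X" .
  next
    fix u v assume uv: "u \<in> V" "v \<in> V" "u \<noteq> v"
    show "measure_pmf.prob (G (pairs V)) {f. colourful V d f u \<and> colourful V d f v \<and> \<not> joined V f v u} \<le> Y"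
      unfolding Y_def
      by (rule not_joined_prob_le[OF V(1) uv, where x = x and h = h])
         (use n l Lx h n1 n2 n3 n4 n5 big in \<open>auto simp: V p_def\<close>)
  qed (simp add: Y_def)
  moreover have "(real (card V))\<^sup>2 * Y = 4 / n ^ 4 + 1 / n\<^sup>2 + 1 / n"
  proof -
    have e: "exp (- real k * L) = 1 / real n ^ k" for k
      using expL by (simp add: exp_minus divide_inverse exp_of_nat_mult)
    show ?thesis unfolding Y_def V using e[of 6] e[of 3] n
      by (simp add: field_simps power_numeral_reduce)
  qed
  moreover have "measure_pmf.prob (G (pairs V)) {f. \<forall>u\<in>V. \<forall>v\<in>V. u \<noteq> v \<longrightarrow> joined V f u v}
     \<le> measure_pmf.prob (coloured_gnp n p s) {(E, col). rainbow_connected {1..n} E col}"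
  proof -
    have "1 \<le> s" using l1 s by simp
    then show ?thesis unfolding coloured_gnp_eq_map[OF \<open>1 \<le> s\<close>] measure_map_pmf complete_edges_eq_pairs V_def
      using joined_rainbow[of n] unfolding complete_edges_eq_pairs
      by (intro measure_pmf.finite_measure_mono) auto
  qed
  ultimately show ?thesis unfolding X_def V by linarith
qed

text \<open>Compare logarithms. The lemma is applied with \<open>y = c * ln n / e\<close>, whose
  logarithm is the denominator in the assumed bound on \<open>s\<close>, and with surplus exponent
  \<open>3 / 2\<close>.\<close>

lemma power_ge_of_exponent_ge:
  fixes y N e B :: real
  assumes "1 < y" "0 < N" "ln N / ln y + e \<le> B" "B \<le> real l"
  shows "N * y powr e \<le> y ^ l"
proof -
  have "ln N + e * ln y = (ln N / ln y + e) * ln y" using assms(1) by (simp add: distrib_right)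
  also have "\<dots> \<le> real l * ln y" using assms by (intro mult_right_mono) auto
  finally have "exp (ln N + e * ln y) \<le> exp (real l * ln y)" by simp
  then show ?thesis using assms by (simp add: exp_add powr_def exp_of_nat_mult)
qed

theorem theorem5p2:
  fixes c :: real and s :: "nat \<Rightarrow> nat"
  assumes "c > 1"
    and "\<And>n. s n \<ge> 1"
    and "\<forall>\<^sub>F n in sequentially.
           real (s n) \<ge> ln (real n) / (ln c - 1 + ln (ln (real n))) + 3 / 2
             + 2 * sqrt (ln (ln (ln (real n)))) / ln (ln (real n))"
  shows "(\<lambda>n. measure_pmf.prob (coloured_gnp n (c * ln (real n) / real n) (s n))
                {(E, col). rainbow_connected {1..n} E col}) \<longlonglongrightarrow> 1"
proof -
  note c = assms(1)
  \<comment> \<open>\<kappa> is the fraction of colours given up at a vertex;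
    \<open>c * (1 - \<kappa>) = (c + 1) / 2\<close> still exceeds 1.\<close>
  define \<kappa> where "\<kappa> = (1 - 1 / c) / 2"
  \<comment> \<open>\<open>\<delta> * L\<close> will bound \<open>l\<close>: the
    \<open>1 / 4\<close> gives \<open>4 * l \<le> L\<close>, and \<open>(c - 1) / 8\<close> keeps
    \<open>exp l\<close> well below the available gain \<open>n powr ((c - 1) / 2)\<close>.\<close>
  define \<delta> where "\<delta> = min (1 / 4) ((c - 1) / 8)"
  have \<kappa>: "0 < \<kappa>" "\<kappa> \<le> 1 / 2" using c by (auto simp: \<kappa>_def field_simps)
  have \<delta>: "0 < \<delta>" "\<delta> \<le> 1 / 4" "\<delta> \<le> (c - 1) / 8"
    using c by (auto simp: \<delta>_def min_def)
  define B where "B n = ln (real n) / (ln c - 1 + ln (ln (real n))) + 3 / 2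
     + 2 * sqrt (ln (ln (ln (real n)))) / ln (ln (real n))" for n :: nat
  define err where "err n = exp ((c + 1) / 2) * exp (- (3 * (c - 1) / 8) * ln (real n))
     + 4 / real n ^ 4 + 1 / (real n)\<^sup>2 + 1 / real n" for n :: nat
  have err: "err \<longlonglongrightarrow> 0"
  proof -
    define a where "a = 3 * (c - 1) / 8"
    have "0 < a" using c by (simp add: a_def)
    then have "(\<lambda>n::nat. exp (- a * ln (real n))) \<longlonglongrightarrow> 0" by real_asymp
    then have "(\<lambda>n::nat. exp ((c + 1) / 2) * exp (- a * ln (real n))) \<longlonglongrightarrow> exp ((c + 1) / 2) * 0"
      by (intro tendsto_mult tendsto_const)
    moreover have "(\<lambda>n::nat. 4 / real n ^ 4) \<longlonglongrightarrow> 0" by real_asymp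
    moreover have "(\<lambda>n::nat. 1 / (real n)\<^sup>2) \<longlonglongrightarrow> 0" by real_asymp
    moreover have "(\<lambda>n::nat. 1 / real n) \<longlonglongrightarrow> 0" by real_asymp
    ultimately have "(\<lambda>n::nat. exp ((c + 1) / 2) * exp (- a * ln (real n))
       + 4 / real n ^ 4 + 1 / (real n)\<^sup>2 + 1 / real n) \<longlonglongrightarrow> exp ((c + 1) / 2) * 0 + 0 + 0 + 0"
      by (intro tendsto_add)
    then show ?thesis unfolding err_def a_def by simp
  qed
  have "\<forall>\<^sub>F n::nat in sequentially. ln (real n) powr (9 / 10) \<le> B n"
    unfolding B_def using c by real_asymp
  moreover have "\<forall>\<^sub>F n::nat in sequentially. B n + 1 \<le> \<delta> * ln (real n)"
    unfolding B_def using c \<delta>(1) by real_asymp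
  moreover have "\<forall>\<^sub>F n::nat in sequentially. 0 < ln c - 1 + ln (ln (real n))" by real_asymp
  moreover have "\<forall>\<^sub>F n::nat in sequentially. 0 \<le> 2 * sqrt (ln (ln (ln (real n)))) / ln (ln (real n))"
    by real_asymp
  moreover have "\<forall>\<^sub>F n::nat in sequentially. 1 \<le> ln (real n)" by real_asymp
  moreover have "\<forall>\<^sub>F n::nat in sequentially. 200006 \<le> \<kappa> / 8 * ln (real n) powr (9 / 10)"
    using \<kappa>(1) by real_asymp
  moreover have "\<forall>\<^sub>F n::nat in sequentially. c * ln (real n) / real n \<le> 1" using c by real_asymp
  moreover have "\<forall>\<^sub>F n::nat in sequentially. 48 * ln (real n) ^ 6 \<le> real n" by real_asymp
  moreover have "\<forall>\<^sub>F n::nat in sequentially.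
     c * ln (real n) / real n * (real n / ln (real n) ^ 3 + 1) \<le> 1 / ln (real n)" using c by real_asymp
  moreover have "\<forall>\<^sub>F n::nat in sequentially.
     4 * (ln (real n) * (c * ln (real n)) ^ 4 + 1) + 2 * ln (real n) + 2 \<le> real n / (2 * ln (real n))"
    using c by real_asymp
  moreover have "\<forall>\<^sub>F n::nat in sequentially.
     c * ln (real n) / real n * (ln (real n) * (c * ln (real n)) ^ 4 + 1) \<le> 1 / 2" using c by real_asymp
  moreover have "\<forall>\<^sub>F n::nat in sequentially.
     real n / (ln (real n))\<^sup>2 + ln (real n) \<le> real n / (2 * ln (real n))" by real_asymp
  \<comment> \<open>The left side has order \<open>L ^ 3\<close>, the right side
    \<open>L powr (3 / 2 + 9 / 5)\<close>: the surplus exponent and two factors \<open>h\<close> of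
    almost linear order together win.\<close>
  moreover have "\<forall>\<^sub>F n::nat in sequentially. 3 * 2 ^ 27 * ln (real n) * (c * ln (real n))\<^sup>2
     \<le> (c * ln (real n) / exp 1) powr (3 / 2) * (\<kappa> / 8 * ln (real n) powr (9 / 10))\<^sup>2"
    using c \<kappa>(1) by real_asymp
  moreover have "\<forall>\<^sub>F n::nat in sequentially. 2 \<le> n" by (rule eventually_ge_at_top)
  ultimately have lower: "\<forall>\<^sub>F n in sequentially. 1 - err n
      \<le> measure_pmf.prob (coloured_gnp n (c * ln (real n) / real n) (s n))
                {(E, col). rainbow_connected {1..n} E col}"
    using assms(3)
  proof eventually_elim
    case (elim n)
    define L where "L = ln (real n)"
    note elim = elim[folded L_def]
    define l where "l = nat \<lceil>B n\<rceil>"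
    \<comment> \<open>Halving \<kappa> gives \<open>2 * d / l \<le> \<kappa>\<close>, as required by
      the factor 2 in \<open>prob_residues_edge_colour_pmf\<close>. The choice of \<open>h\<close>
      ensures \<open>2 * h + 1 \<le> d\<close>, and \<open>y\<close> is an explicit lower bound for
      \<open>h - 6\<close>.\<close>
    define d where "d = nat \<lfloor>\<kappa> / 2 * real l\<rfloor>"
    define h where "h = (d - 1) div 2"
    define y where "y = \<kappa> / 8 * L powr (9 / 10)"
    have L1: "1 \<le> L" using elim by simp
    have n0: "0 < real n" using elim by simp
    have B0: "0 \<le> B n" using elim(1) by (rule order_trans[rotated]) simp
    have l: "B n \<le> real l" "real l \<le> B n + 1" unfolding l_def using B0 by linarith+
    have lL: "real l \<le> \<delta> * L" using l elim(2) by linarith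
    have yl: "y \<le> \<kappa> / 8 * real l" unfolding y_def using elim(1) l \<kappa> by (intro mult_left_mono) auto
    have y: "200006 \<le> y" using elim by (simp add: y_def)
    have dl: "real d \<le> \<kappa> / 2 * real l" "\<kappa> / 2 * real l - 1 < real d"
    proof -
      have "0 \<le> \<kappa> / 2 * real l" using \<kappa> by simp
      then show "real d \<le> \<kappa> / 2 * real l" "\<kappa> / 2 * real l - 1 < real d"
        unfolding d_def by linarith+
    qed
    have hd: "2 * h + 1 \<le> d" using dl y yl unfolding h_def by linarith
    have hy: "y \<le> real h - 6" using dl y yl unfolding h_def by linarith
    have "\<delta> * L \<le> 1 / 4 * L" using \<delta> L1 by (intro mult_right_mono) auto
    then have l4: "4 * real l \<le> L" using lL by linarith
    have \<kappa>l: "\<kappa> / 2 * real l \<le> real l" using \<kappa> mult_right_mono[of "\<kappa> / 2" 1 "real l"] by linarith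
    have yl2: "y \<le> real l" using yl \<kappa> mult_right_mono[of "\<kappa> / 8" 1 "real l"] by linarith
    have l24: "24 \<le> l" using y yl2 by linarith
    have hL: "real h \<le> L" using hd dl \<kappa>l l4 by linarith
    have "l \<le> s n" using elim unfolding l_def B_def L_def by linarith
    have "1 - (n * (exp l * exp (- (c * L / n * (1 - \<kappa>) * (real n - 1)))) + 4 / n ^ 4 + 1 / n\<^sup>2 + 1 / n)
      \<le> measure_pmf.prob (coloured_gnp n (c * L / n) (s n)) {(E, col). rainbow_connected {1..n} E col}"
    proof (rule rainbow_connected_prob[OF L_def])
      show "2 * real d / real l \<le> \<kappa>" using dl l24 by (simp add: field_simps)
      have "1 * L \<le> c * L" using c L1 by (intro mult_right_mono) auto
      then show "L \<le> c * L" by simp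
      show "3 * 2 ^ 27 * L * (c * L)\<^sup>2 * real n \<le> (c * L / exp 1) ^ l * (real h * (real h - 6))"
      proof -
        have lnx: "ln (c * L / exp 1) = ln c - 1 + ln L"
          using c L1 by (simp add: ln_div ln_mult)
        have A: "real n * (c * L / exp 1) powr (3 / 2) \<le> (c * L / exp 1) ^ l"
        proof (rule power_ge_of_exponent_ge)
          have "0 < ln (c * L / exp 1)" using elim lnx by simp
          then show "1 < c * L / exp 1" using c L1 by (subst (asm) ln_gt_zero_iff) auto
          show "ln (real n) / ln (c * L / exp 1) + 3 / 2 \<le> B n"
            unfolding lnx using elim(4) by (simp add: B_def L_def)
        qed (use n0 l in auto)
        have B: "y\<^sup>2 \<le> real h * (real h - 6)"
          unfolding power2_eq_square using hy y by (intro mult_mono) linarith+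
        have "real n * (c * L / exp 1) powr (3 / 2) * y\<^sup>2
            \<le> (c * L / exp 1) ^ l * (real h * (real h - 6))"
          by (rule mult_mono[OF A B]) (use c L1 in auto)
        moreover have "real n * (3 * 2 ^ 27 * L * (c * L)\<^sup>2) \<le> real n * ((c * L / exp 1) powr (3 / 2) * y\<^sup>2)"
          using elim n0 unfolding y_def by (intro mult_left_mono) auto
        ultimately show ?thesis by (simp add: mult_ac)
      qed
    qed (use elim hd hy y l24 l4 hL \<kappa> \<open>l \<le> s n\<close> in auto)
    moreover have "n * (exp l * exp (- (c * L / n * (1 - \<kappa>) * (real n - 1))))
        \<le> exp ((c + 1) / 2) * exp (- (3 * (c - 1) / 8) * L)"
    proof -
      have ck: "c * (1 - \<kappa>) = (c + 1) / 2" using c by (simp add: \<kappa>_def field_simps)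
      have "c * L / n * (1 - \<kappa>) * (real n - 1) = c * (1 - \<kappa>) * (L * ((real n - 1) / n))"
        by simp
      also have "\<dots> = (c + 1) / 2 * (L * ((real n - 1) / n))" unfolding ck ..
      also have "\<dots> = (c + 1) / 2 * L - (c + 1) / 2 * (L / n)" using n0 by (simp add: field_simps)
      finally have e: "c * L / n * (1 - \<kappa>) * (real n - 1) = (c + 1) / 2 * L - (c + 1) / 2 * (L / n)" .
      \<comment> \<open>Having \<open>n - 1\<close> instead of \<open>n\<close> potential neighbours
        costs only the constant factor \<open>exp ((c + 1) / 2)\<close> in
        \<open>err\<close>.\<close>
      have "L / n \<le> 1" using ln_le_minus_one[OF n0] n0 by (simp add: L_def)
      then have "(c + 1) / 2 * (L / n) \<le> (c + 1) / 2 * 1" using c by (intro mult_left_mono) auto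
      moreover have coeff: "L + (c - 1) / 8 * L - (c + 1) / 2 * L = - (3 * (c - 1) / 8 * L)"
        by (simp add: field_simps)
      moreover have "real l \<le> (c - 1) / 8 * L"
        using lL mult_right_mono[OF \<delta>(3), of L] L1 by linarith
      ultimately have "L + real l - c * L / n * (1 - \<kappa>) * (real n - 1) \<le> (c + 1) / 2 - 3 * (c - 1) / 8 * L"
        unfolding e using coeff by linarith
      then have le: "L + real l + - (c * L / n * (1 - \<kappa>) * (real n - 1))
          \<le> (c + 1) / 2 + - (3 * (c - 1) / 8) * L"
        by linarith
      have "exp L = real n" using n0 by (simp add: L_def)
      then have "n * (exp l * exp (- (c * L / n * (1 - \<kappa>) * (real n - 1))))
          = exp (L + real l + - (c * L / n * (1 - \<kappa>) * (real n - 1)))"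
        by (simp only: exp_add mult.assoc)
      also have "\<dots> \<le> exp ((c + 1) / 2 + - (3 * (c - 1) / 8) * L)" using le by (simp only: exp_le_cancel_iff)
      finally show ?thesis by (simp only: exp_add)
    qed
    ultimately show ?case unfolding err_def L_def of_nat_power by linarith
  qed
  have "(\<lambda>n. 1 - err n) \<longlonglongrightarrow> 1 - 0" by (intro tendsto_diff tendsto_const err)
  then have lim: "(\<lambda>n. 1 - err n) \<longlonglongrightarrow> 1" by simp
  show ?thesis
    by (rule tendsto_sandwich[OF lower _ lim tendsto_const]) (simp add: measure_pmf.prob_le_1)
qed

end
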